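(* Let $G$ be a nonempty finite simple chordal graph without isolated vertices. Then the cover ideal $J(G)$ is Scarf if and only if $V(G)$ can be partitioned into a clique $A$ and an independent set $B$ such that (1) every vertex in $A$ is adjacent to a vertex in $B$; (2) no two sets in the collection $\{N_G(x)\cap B : x\in A\}$ contain one another, i.e., for all distinct $x,x'\in A$, $N_G(x)\cap B\not\subseteq N_G(x')\cap B$.
   Context: Let $\Bbbk$ be a field and $S=\Bbbk[V(G)]$ the polynomial ring whose variables are the vertices of $G$. A vertex cover of $G$ is a set of vertices meeting every edge. The cover ideal is $J(G)=\left(\prod_{x\in W}x : W\subseteq V(G)\text{ is a vertex cover of }G\right)\subseteq S$. A graph is chordal if it has no induced cycle of length $\geq 4$. $N_G(x)$ is the set of vertices adjacent to $x$. A clique is a set of pairwise adjacent vertices; an independent set is a set of pairwise non-adjacent vertices. Scarf ideals: for a monomial ideal $I$ let $\operatorname{Mingens}(I)$ be its set of minimal monomial generators. The Taylor resolution of $S/I$ has free basis $e_\sigma$, $\sigma\subseteq\operatorname{Mingens}(I)$, with $e_\sigma$ in homological degree $|\sigma|$ and $\partial(e_\sigma)=\sum_{j=1}^t(-1)^{j+1}\frac{\operatorname{lcm}(\sigma)}{\operatorname{lcm}(\sigma\setminus\{m_{i_j}\})}e_{\sigma\setminus\{m_{i_j}\}}$ for $\sigma=\{m_{i_1},\dots,m_{i_t}\}$. The Scarf complex of $I$ is the simplicial complex of all $\sigma\subseteq\operatorname{Mingens}(I)$ such that $\operatorname{lcm}(\sigma)\neq\operatorname{lcm}(\tau)$ for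 every $\tau\subseteq\operatorname{Mingens}(I)$ with $\tau\neq\sigma$. It induces a subcomplex of the Taylor resolution (spanned by the $e_\sigma$ with $\sigma$ in the Scarf complex). $I$ is called Scarf if this subcomplex is a minimal free resolution of $S/I$ (equivalently, a free resolution of $S/I$). *)

theory Defs
  imports "HOL-Library.Poly_Mapping" "HOL-Library.Ramsey" "HOL-Algebra.QuotRing" "HOL-Algebra.Module"
begin

section \<open>Graphs\<close>

text \<open>A graph is given by its vertex set \<open>V\<close> and its set \<open>E\<close> of two-element edges.
  \<^const>\<open>clique\<close> and \<^const>\<open>indep\<close> are taken from \<^theory>\<open>HOL-Library.Ramsey\<close>; there, the first
  argument is the set of vertices that is claimed to be a clique or independent.\<close>

definition finite_simple_graph :: "'v set \<Rightarrow> 'v set set \<Rightarrow> bool" where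
  "finite_simple_graph V E \<longleftrightarrow> finite V \<and> (\<forall>e\<in>E. e \<subseteq> V \<and> card e = 2)"

definition nbhd :: "'v set \<Rightarrow> 'v set set \<Rightarrow> 'v \<Rightarrow> 'v set" where
  "nbhd V E x = {y \<in> V. {x, y} \<in> E}"

definition vertex_cover :: "'v set \<Rightarrow> 'v set set \<Rightarrow> 'v set \<Rightarrow> bool" where
  "vertex_cover V E W \<longleftrightarrow> W \<subseteq> V \<and> (\<forall>e\<in>E. W \<inter> e \<noteq> {})"

definition induced_cycle :: "'v set \<Rightarrow> 'v set set \<Rightarrow> 'v list \<Rightarrow> bool" where
  "induced_cycle V E c \<longleftrightarrow> 3 \<le> length c \<and> distinct c \<and> set c \<subseteq> V \<and>
     (\<forall>i<length c. \<forall>j<length c.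
        {c ! i, c ! j} \<in> E \<longleftrightarrow> j = Suc i mod length c \<or> i = Suc j mod length c)"

definition chordal :: "'v set \<Rightarrow> 'v set set \<Rightarrow> bool" where
  "chordal V E \<longleftrightarrow> \<not> (\<exists>c. induced_cycle V E c \<and> 4 \<le> length c)"


section \<open>Polynomial rings\<close>

text \<open>A monomial is represented by its exponent vector, a polynomial by its finitely supported
  family of coefficients. The polynomial ring over \<open>'k\<close> with variables \<open>V\<close> is the subring of the
  polynomials in which only variables from \<open>V\<close> occur.\<close>

type_synonym 'v mon = "'v \<Rightarrow>\<^sub>0 nat"
type_synonym ('v, 'k) mpoly = "'v mon \<Rightarrow>\<^sub>0 'k"

definition poly_ring :: "'v set \<Rightarrow> ('v, 'k::field) mpoly ring" where
  "poly_ring V = \<lparr>carrier = {p. \<forall>m \<in> Poly_Mapping.keys p. Poly_Mapping.keys m \<subseteq> V},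
     monoid.mult = (*), one = 1, ring.zero = 0, add = (+)\<rparr>"

definition var :: "'v \<Rightarrow> ('v, 'k::field) mpoly" where
  "var x = Poly_Mapping.single (Poly_Mapping.single x 1) 1"

definition irrelevant_ideal :: "'v set \<Rightarrow> ('v, 'k::field) mpoly set" where
  "irrelevant_ideal V = Idl\<^bsub>poly_ring V\<^esub> (var ` V)"

definition cover_ideal :: "'v set \<Rightarrow> 'v set set \<Rightarrow> ('v, 'k::field) mpoly set" where
  "cover_ideal V E = Idl\<^bsub>poly_ring V\<^esub> {\<Prod>x\<in>W. var x | W. vertex_cover V E W}"

definition mon_dvd :: "'v mon \<Rightarrow> 'v mon \<Rightarrow> bool" where
  "mon_dvd m n \<longleftrightarrow> (\<exists>r. n = m + r)"

text \<open>The minimal monomial generators of a monomial ideal \<open>I\<close>: the monomials of \<open>I\<close> that are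
  not divisible by any other monomial of \<open>I\<close>.\<close>

definition mingens :: "('v, 'k::field) mpoly set \<Rightarrow> 'v mon set" where
  "mingens I = {m. Poly_Mapping.single m 1 \<in> I \<and>
     (\<forall>n. Poly_Mapping.single n 1 \<in> I \<and> mon_dvd n m \<longrightarrow> n = m)}"

text \<open>The least common multiple of a finite set of monomials; in particular the empty set has
  least common multiple \<open>1\<close>, that is, exponent vector \<open>0\<close>.\<close>

definition mon_lcm :: "'v mon set \<Rightarrow> 'v mon" where
  "mon_lcm \<sigma> = Abs_poly_mapping (\<lambda>x. Max (insert 0 ((\<lambda>m. Poly_Mapping.lookup m x) ` \<sigma>)))"


section \<open>Minimal free resolutions\<close>

text \<open>The record type of modules extends that of rings; the fields \<open>mult\<close> and \<open>one\<close> play no role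
  for a module.\<close>

definition free_module :: "('a, 'r) ring_scheme \<Rightarrow> 'b set \<Rightarrow> ('a, 'b \<Rightarrow> 'a) module" where
  "free_module R B =
     \<lparr>carrier = {c. (\<forall>b\<in>B. c b \<in> carrier R) \<and> (\<forall>b. b \<notin> B \<longrightarrow> c b = \<zero>\<^bsub>R\<^esub>) \<and>
                    finite {b. c b \<noteq> \<zero>\<^bsub>R\<^esub>}},
      monoid.mult = undefined, one = undefined,
      ring.zero = (\<lambda>b. \<zero>\<^bsub>R\<^esub>), add = (\<lambda>c d b. c b \<oplus>\<^bsub>R\<^esub> d b),
      smult = (\<lambda>a c b. a \<otimes>\<^bsub>R\<^esub> c b)\<rparr>"

definition quotient_module :: "('a, 'r) ring_scheme \<Rightarrow> 'a set \<Rightarrow> ('a, 'a set) module" where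
  "quotient_module R I =
     \<lparr>carrier = carrier (R Quot I), monoid.mult = undefined, one = undefined,
      ring.zero = \<zero>\<^bsub>R Quot I\<^esub>, add = add (R Quot I),
      smult = (\<lambda>a c. (I +>\<^bsub>R\<^esub> a) \<otimes>\<^bsub>R Quot I\<^esub> c)\<rparr>"

definition module_hom ::
  "('a, 'r) ring_scheme \<Rightarrow> ('a, 'm) module \<Rightarrow> ('a, 'n) module \<Rightarrow> ('m \<Rightarrow> 'n) set" where
  "module_hom R M N = {f \<in> carrier M \<rightarrow> carrier N.
     (\<forall>x\<in>carrier M. \<forall>y\<in>carrier M. f (x \<oplus>\<^bsub>M\<^esub> y) = f x \<oplus>\<^bsub>N\<^esub> f y) \<and>
     (\<forall>a\<in>carrier R. \<forall>x\<in>carrier M. f (a \<odot>\<^bsub>M\<^esub> x) = a \<odot>\<^bsub>N\<^esub> f x)}"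

definition module_ker :: "('a, 'm) module \<Rightarrow> ('a, 'n) module \<Rightarrow> ('m \<Rightarrow> 'n) \<Rightarrow> 'm set" where
  "module_ker M N f = {x \<in> carrier M. f x = \<zero>\<^bsub>N\<^esub>}"

text \<open>The free modules \<open>F i\<close> with bases \<open>B i\<close>, the differentials \<open>d i : F (i + 1) \<rightarrow> F i\<close> and the
  augmentation \<open>\<epsilon> : F 0 \<rightarrow> M\<close> form a free resolution of \<open>M\<close>.\<close>

definition free_resolution ::
  "('a, 'r) ring_scheme \<Rightarrow> ('a, 'm) module \<Rightarrow> (nat \<Rightarrow> 'b set) \<Rightarrow>
     (nat \<Rightarrow> ('b \<Rightarrow> 'a) \<Rightarrow> ('b \<Rightarrow> 'a)) \<Rightarrow> (('b \<Rightarrow> 'a) \<Rightarrow> 'm) \<Rightarrow> bool" where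
  "free_resolution R M B d \<epsilon> \<longleftrightarrow> (let F = (\<lambda>i. free_module R (B i)) in
     (\<forall>i. d i \<in> module_hom R (F (Suc i)) (F i)) \<and>
     \<epsilon> \<in> module_hom R (F 0) M \<and>
     (\<forall>i. d (Suc i) ` carrier (F (Suc (Suc i))) = module_ker (F (Suc i)) (F i) (d i)) \<and>
     d 0 ` carrier (F 1) = module_ker (F 0) M \<epsilon> \<and>
     \<epsilon> ` carrier (F 0) = carrier M)"

text \<open>Minimality with respect to an ideal \<open>\<mm>\<close> means \<open>d i (F (i + 1)) \<subseteq> \<mm> F i\<close>; as \<open>F i\<close> is free on
  \<open>B i\<close>, the submodule \<open>\<mm> F i\<close> consists of the elements all of whose coefficients are in \<open>\<mm>\<close>.\<close>

definition minimal_free_resolution ::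
  "('a, 'r) ring_scheme \<Rightarrow> 'a set \<Rightarrow> ('a, 'm) module \<Rightarrow> (nat \<Rightarrow> 'b set) \<Rightarrow>
     (nat \<Rightarrow> ('b \<Rightarrow> 'a) \<Rightarrow> ('b \<Rightarrow> 'a)) \<Rightarrow> (('b \<Rightarrow> 'a) \<Rightarrow> 'm) \<Rightarrow> bool" where
  "minimal_free_resolution R \<mm> M B d \<epsilon> \<longleftrightarrow> free_resolution R M B d \<epsilon> \<and>
     (\<forall>i. \<forall>c \<in> carrier (free_module R (B (Suc i))). \<forall>b \<in> B i. d i c b \<in> \<mm>)"


section \<open>The Taylor resolution and Scarf ideals\<close>

text \<open>The list \<open>ms\<close> enumerates the minimal generators; it fixes the order that enters the signs of
  the Taylor differential. Since list positions start from \<open>0\<close>, the sign \<open>(-1)^(j + 1)\<close> of the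
  usual formula becomes \<open>(-1)^j\<close>. The value \<open>taylor_basis_diff ms \<sigma> \<tau>\<close> is the coefficient
  of \<open>e\<^sub>\<tau>\<close> in the differential of \<open>e\<^sub>\<sigma>\<close>.\<close>

definition taylor_basis_diff ::
  "'v mon list \<Rightarrow> 'v mon set \<Rightarrow> 'v mon set \<Rightarrow> ('v, 'k::field) mpoly" where
  "taylor_basis_diff ms \<sigma> \<tau> = (let l = filter (\<lambda>m. m \<in> \<sigma>) ms in
     \<Sum>j<length l. if \<tau> = \<sigma> - {l ! j}
       then (-1) ^ j * Poly_Mapping.single (mon_lcm \<sigma> - mon_lcm (\<sigma> - {l ! j})) 1 else 0)"

definition taylor_diff ::
  "'v mon list \<Rightarrow> ('v mon set \<Rightarrow> ('v, 'k::field) mpoly) \<Rightarrow> ('v mon set \<Rightarrow> ('v, 'k) mpoly)" where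
  "taylor_diff ms c = (\<lambda>\<tau>. \<Sum>\<sigma>\<in>Pow (set ms). c \<sigma> * taylor_basis_diff ms \<sigma> \<tau>)"

definition scarf_complex :: "'v mon set \<Rightarrow> 'v mon set set" where
  "scarf_complex M = {\<sigma>. \<sigma> \<subseteq> M \<and> (\<forall>\<tau>. \<tau> \<subseteq> M \<and> \<tau> \<noteq> \<sigma> \<longrightarrow> mon_lcm \<sigma> \<noteq> mon_lcm \<tau>)}"

text \<open>The augmentation to \<open>S/I\<close> sends the basis element of the empty set to \<open>1 + I\<close>. Different
  enumerations \<open>ms\<close> of the minimal generators yield isomorphic complexes, so that it is immaterial
  which one is used.\<close>

definition scarf_ideal :: "'v set \<Rightarrow> ('v, 'k::field) mpoly set \<Rightarrow> bool" where
  "scarf_ideal V I \<longleftrightarrow> (\<exists>ms. distinct ms \<and> set ms = mingens I \<and>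
     minimal_free_resolution (poly_ring V) (irrelevant_ideal V) (quotient_module (poly_ring V) I)
       (\<lambda>i. {\<sigma> \<in> scarf_complex (mingens I). card \<sigma> = i})
       (\<lambda>i. taylor_diff ms)
       (\<lambda>c. I +>\<^bsub>poly_ring V\<^esub> c {}))"

end

theory Submission
  imports Defs
begin

text \<open>
  Minimal generators of the cover ideal correspond to minimal vertex covers, and the lcm of a set
  of generators to the union of the covers. A Scarf face never has three elements, so the cover
  ideal is Scarf iff the graph of Scarf pairs is a tree in which, for every \<open>U\<close>, the covers
  avoiding \<open>U\<close> span a connected subgraph. For vertices \<open>x\<close>, the covers avoiding \<open>x\<close> then form
  subtrees, two of which are disjoint if the vertices are adjacent and meet otherwise. An induced
  pair of disjoint edges would give a 4-cycle of subtrees, which a tree does not admit; a chordal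
  graph without such a pair is split. Taking \<open>B\<close> maximal gives (1), and then the minimal
  covers are \<open>A\<close> and \<open>A - {a} \<union> N(a) \<inter> B\<close> for \<open>a \<in> A\<close>. If (2) fails, one of the latter is an
  isolated vertex of the graph of Scarf pairs. If (2) holds, this graph is a star with centre \<open>A\<close>, and
  exactness is immediate, since all generators except the one of \<open>a\<close> are divisible by the variable \<open>a\<close>.
\<close>


section \<open>Split graphs and minimal vertex covers\<close>

text \<open>No notion of path or tree occurs below. Both halves of the tree condition are statements
  about weighted chains on the Scarf pairs, with coefficients in the ground field: acyclic means
  that a chain with zero boundary vanishes on every Scarf pair, and connectedness of the covers
  avoiding \<open>U\<close> means that the difference of any two of them is the boundary of a chain
  on pairs that avoid \<open>U\<close>. In this form both are strands of the resolution in one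
  squarefree multidegree: the product of all of \<open>V\<close> for injectivity of the differential
  on pairs, and the product of \<open>V - U\<close> for exactness at the generators. The obstacle is
  that the cycle made from two independent edges must be recognised as nonzero without reference to
  paths; a linear functional on chains, with value -1 on it, does this. For the converse, every pair
  of the star has a leaf, where the differential is multiplication by one variable up to sign, so
  coefficients are compared at the leaves and only the centre is left over.\<close>

definition min_cover :: "'v set \<Rightarrow> 'v set set \<Rightarrow> 'v set \<Rightarrow> bool" where
  "min_cover V E W \<longleftrightarrow> vertex_cover V E W \<and> (\<forall>W'. vertex_cover V E W' \<and> W' \<subseteq> W \<longrightarrow> W' = W)"

text \<open>The Scarf complex of the cover ideal, with a squarefree monomial replaced by its set of variables.\<close>

definition scarf_family :: "'v set \<Rightarrow> 'v set set \<Rightarrow> 'v set set set" where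
  "scarf_family V E = {\<W>. \<W> \<subseteq> Collect (min_cover V E) \<and>
     (\<forall>\<T>. \<T> \<subseteq> Collect (min_cover V E) \<and> \<Union>\<T> = \<Union>\<W> \<longrightarrow> \<T> = \<W>)}"

definition scarf_edges :: "'v set \<Rightarrow> 'v set set \<Rightarrow> 'v set set set" where
  "scarf_edges V E = {\<W> \<in> scarf_family V E. card \<W> = 2}"

text \<open>The boundary map of a signed graph: the Taylor differential on pairs with all monomials
  set to 1. The signs \<open>s\<close> are a parameter because Taylor's signs depend on an
  enumeration of the generators, while the combinatorial part asks only that they be opposite at the
  two ends of a pair. Values of \<open>f\<close> off \<open>scarf_edges\<close> do not
  enter.\<close>

definition scarf_boundary ::
    "'v set \<Rightarrow> 'v set set \<Rightarrow> ('v set set \<Rightarrow> 'v set \<Rightarrow> 'k::field) \<Rightarrow> ('v set set \<Rightarrow> 'k) \<Rightarrow> 'v set \<Rightarrow> 'k" where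
  "scarf_boundary V E s f W = (\<Sum>\<W> | \<W> \<in> scarf_edges V E \<and> W \<in> \<W>. s \<W> W * f \<W>)"

locale simple_graph =
  fixes V :: "'v set" and E :: "'v set set"
  assumes graph: "finite_simple_graph V E"
begin

lemma finite_V: "finite V"
  using graph by (simp add: finite_simple_graph_def)

lemma edgeD: "{x, y} \<in> E \<Longrightarrow> x \<in> V \<and> y \<in> V \<and> x \<noteq> y"
  using graph by (fastforce simp: finite_simple_graph_def card_2_iff)

lemma no_loop: "{x} \<notin> E"
  using edgeD[of x x] by auto

lemma edge_commute: "{x, y} \<in> E \<longleftrightarrow> {y, x} \<in> E"
  by (simp add: insert_commute)

lemma edgeE:
  assumes "e \<in> E"
  obtains x y where "e = {x, y}" "x \<noteq> y" "x \<in> V" "y \<in> V"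
  using assms graph unfolding finite_simple_graph_def card_2_iff
  by (metis insert_subset)

lemma non_edge_commute: "{x, y} \<notin> E \<Longrightarrow> {y, x} \<notin> E"
  by (simp add: insert_commute)

section \<open>Forbidden induced subgraphs and split partitions\<close>

lemma no_induced_C4:
  assumes "chordal V E"
    and edges: "{a, b} \<in> E" "{b, c} \<in> E" "{c, d} \<in> E" "{d, a} \<in> E"
    and nonedges: "{a, c} \<notin> E" "{b, d} \<notin> E"
    and "a \<noteq> c" "b \<noteq> d"
  shows False
proof -
  let ?c = "[a, b, c, d]"
  note edges' = edges edges[THEN edge_commute[THEN iffD1]]
  note nonedges' = nonedges nonedges[THEN non_edge_commute]
  have dist: "distinct ?c" and sub: "set ?c \<subseteq> V"
    using edges[THEN edgeD] assms(8,9) by auto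
  have "{?c ! i, ?c ! j} \<in> E \<longleftrightarrow> j = Suc i mod 4 \<or> i = Suc j mod 4" if "i < 4" "j < 4" for i j
  proof -
    have "i \<in> {0, 1, 2, 3}" "j \<in> {0, 1, 2, 3}"
      using that by auto
    then show ?thesis
      by (elim insertE emptyE; simp only:; simp add: edges' nonedges' no_loop)
  qed
  then have "induced_cycle V E ?c"
    unfolding induced_cycle_def using dist sub by simp
  then have "\<not> 4 \<le> length ?c"
    using assms(1) unfolding chordal_def by blast
  then show False
    by simp
qed

lemma no_induced_C5:
  assumes "chordal V E"
    and edges: "{a, b} \<in> E" "{b, c} \<in> E" "{c, d} \<in> E" "{d, e} \<in> E" "{e, a} \<in> E"
    and nonedges: "{a, c} \<notin> E" "{b, d} \<notin> E" "{c, e} \<notin> E" "{d, a} \<notin> E" "{e, b} \<notin> E"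
    and dist: "distinct [a, b, c, d, e]"
  shows False
proof -
  let ?c = "[a, b, c, d, e]"
  note edges' = edges edges[THEN edge_commute[THEN iffD1]]
  note nonedges' = nonedges nonedges[THEN non_edge_commute]
  have sub: "set ?c \<subseteq> V"
    using edges[THEN edgeD] by auto
  have "{?c ! i, ?c ! j} \<in> E \<longleftrightarrow> j = Suc i mod 5 \<or> i = Suc j mod 5" if "i < 5" "j < 5" for i j
  proof -
    have "i \<in> {0, 1, 2, 3, 4}" "j \<in> {0, 1, 2, 3, 4}"
      using that by auto
    then show ?thesis
      by (elim insertE emptyE; simp only:; simp add: edges' nonedges' no_loop)
  qed
  then have "induced_cycle V E ?c"
    unfolding induced_cycle_def using dist sub by simp
  then have "\<not> 4 \<le> length ?c"
    using assms(1) unfolding chordal_def by blast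
  then show False
    by simp
qed

text \<open>Foldes and Hammer: among the maximum cliques, take one whose complement spans the fewest edges.\<close>

lemma split_of_no_2K2:
  assumes chordal: "chordal V E"
    and no_2K2: "\<And>a b c d. \<lbrakk>{a, b} \<in> E; {c, d} \<in> E; {a, c} \<notin> E; {a, d} \<notin> E; {b, c} \<notin> E; {b, d} \<notin> E\<rbrakk> \<Longrightarrow> False"
  obtains A B where "A \<union> B = V" "A \<inter> B = {}" "clique A E" "indep B E"
proof -
  define outer where "outer A = {e \<in> E. e \<inter> A = {}}" for A
  have "E \<subseteq> Pow V"
    using graph by (auto simp: finite_simple_graph_def)
  then have "finite E"
    using finite_V finite_subset by blast
  then have fin_outer: "finite (outer A)" for A
    unfolding outer_def by simp
  have fin: "finite A" if "A \<subseteq> V" for A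
    using that finite_V finite_subset by blast
  have "\<exists>A. (A \<subseteq> V \<and> clique A E) \<and> (\<forall>A'. A' \<subseteq> V \<and> clique A' E \<longrightarrow> card A' \<le> card A)"
    by (rule ex_has_greatest_nat[of _ "{}" _ "Suc (card V)"])
      (simp_all add: clique_def less_Suc_eq_le card_mono[OF finite_V])
  then obtain A0 where A0: "A0 \<subseteq> V" "clique A0 E" "\<And>A'. A' \<subseteq> V \<Longrightarrow> clique A' E \<Longrightarrow> card A' \<le> card A0"
    by blast
  obtain A where A: "A \<subseteq> V" "clique A E" "card A = card A0"
    and least: "\<And>A'. A' \<subseteq> V \<Longrightarrow> clique A' E \<Longrightarrow> card A' = card A0 \<Longrightarrow> card (outer A) \<le> card (outer A')"
    using ex_has_least_nat[of "\<lambda>A. A \<subseteq> V \<and> clique A E \<and> card A = card A0" A0 "\<lambda>A. card (outer A)"] A0(1,2)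
    by metis
  have finA: "finite A"
    using A(1) fin by blast
  define N where "N x = {u \<in> A. {x, u} \<notin> E}" for x
  have clique_insert: "clique (insert x C) E" if "clique C E" "\<And>u. u \<in> C \<Longrightarrow> {x, u} \<in> E" for x C
    using that unfolding clique_def by (auto simp: insert_commute)
  have clique_sub: "clique C E" if "C \<subseteq> A" for C
    using A(2) that unfolding clique_def by blast
  have N_ne: "N x \<noteq> {}" if "x \<in> V - A" for x
  proof
    assume "N x = {}"
    then have "clique (insert x A) E"
      unfolding N_def by (intro clique_insert A(2)) blast
    then show False
      using A0(3)[of "insert x A"] A that finA by auto
  qed
  \<comment> \<open>If the two sets are incomparable, a vertex \<open>u\<close> missed by
    \<open>x\<close> only and a vertex \<open>v\<close> missed by \<open>y\<close> only complete the
    edge to an induced 4-cycle \<open>x\<close>, \<open>y\<close>, \<open>u\<close>,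
    \<open>v\<close>.\<close>
  have nested: "N x \<subseteq> N y \<or> N y \<subseteq> N x" if "{x, y} \<in> E" "x \<in> V - A" "y \<in> V - A" for x y
  proof (rule ccontr)
    assume "\<not> ?thesis"
    then obtain u v where "u \<in> A" "{x, u} \<notin> E" "{y, u} \<in> E" "v \<in> A" "{x, v} \<in> E" "{y, v} \<notin> E"
      unfolding N_def by blast
    moreover from this have "{u, v} \<in> E"
      using A(2) unfolding clique_def by metis
    ultimately show False
      using no_induced_C4[OF chordal, of x y u v] that by (auto simp: insert_commute)
  qed
  \<comment> \<open>Two common non-neighbours of \<open>x\<close> and \<open>y\<close> are joined
    inside the clique, and this edge would be independent of the edge \<open>{x, y}\<close>.\<close>
  have common: "u = v" if "{x, y} \<in> E" "u \<in> N x \<inter> N y" "v \<in> N x \<inter> N y" for x y u v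
  proof (rule ccontr)
    assume "u \<noteq> v"
    then have "{u, v} \<in> E"
      using that A(2) unfolding N_def clique_def by blast
    then show False
      using no_2K2[of x y u v] that unfolding N_def by blast
  qed
  \<comment> \<open>Here \<open>N x\<close> shrinks to one vertex \<open>z\<close>, so
    \<open>z\<close> can be exchanged for \<open>x\<close> within the maximum cliques. The
    contradiction comes from a second non-neighbour \<open>w\<close> of \<open>y\<close> in the
    clique and a neighbour \<open>t\<close> of \<open>z\<close> outside it that \<open>x\<close>
    does not see.\<close>
  have no_edge: False if xy: "{x, y} \<in> E" and x: "x \<in> V - A" and y: "y \<in> V - A" and sub: "N x \<subseteq> N y" for x y
  proof -
    obtain z where z: "N x = {z}"
      using N_ne[OF x] common[OF xy] sub by (metis Int_absorb2 is_singletonI' is_singleton_the_elem)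
    have zA: "z \<in> A" "{x, z} \<notin> E" "{y, z} \<notin> E"
      using z sub unfolding N_def by auto
    have x_adj: "{x, u} \<in> E" if "u \<in> A" "u \<noteq> z" for u
      using z that unfolding N_def by blast
    have cl: "clique (insert x (A - {z})) E"
      by (intro clique_insert clique_sub) (use x_adj in auto)
    have card_cl: "card (insert x (A - {z})) = card A"
      using x zA(1) finA by (metis DiffD1 DiffD2 card_Suc_Diff1 card_insert_disjoint finite_Diff)
    \<comment> \<open>If \<open>y\<close> missed no vertex of the clique but \<open>z\<close>, then
      \<open>x\<close> and \<open>y\<close> together could replace \<open>z\<close>, which enlarges
      a maximum clique.\<close>
    obtain w where w: "w \<in> A" "{y, w} \<notin> E" "w \<noteq> z"
    proof (rule ccontr)
      assume "\<not> thesis"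
      with that have "{y, u} \<in> E" if "u \<in> A" "u \<noteq> z" for u
        using \<open>u \<in> A\<close> \<open>u \<noteq> z\<close> by blast
      then have "clique (insert y (insert x (A - {z}))) E"
        using xy by (intro clique_insert[OF cl]) (auto simp: insert_commute)
      moreover have "y \<notin> insert x (A - {z})"
        using y edgeD[OF xy] by auto
      ultimately show False
        using A0(3)[of "insert y (insert x (A - {z}))"] x y A(1,3) card_cl finA by auto
    qed
    \<comment> \<open>The choice of \<open>A\<close> by the size of \<open>outer\<close> enters
      here. If no such \<open>t\<close> exists, exchanging \<open>z\<close> for \<open>x\<close>
      sends every newly uncovered edge \<open>{z, s}\<close> injectively to an edge
      \<open>{x, s}\<close> that is no longer counted, and the edge \<open>{x, y}\<close> is lost on
      top of these.\<close>
    obtain t where t: "{z, t} \<in> E" "t \<notin> A" "{x, t} \<notin> E"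
    proof (rule ccontr)
      assume "\<not> thesis"
      with that have t: "{x, t} \<in> E" if "{z, t} \<in> E" "t \<notin> A" for t
        using \<open>{z, t} \<in> E\<close> \<open>t \<notin> A\<close> by blast
      let ?A' = "insert x (A - {z})"
      have new: "\<exists>t. e = {z, t} \<and> {z, t} \<in> E \<and> t \<notin> A \<and> t \<noteq> x" if e: "e \<in> outer ?A' - outer A" for e
      proof -
        have "e \<in> E" "x \<notin> e" "z \<in> e" "e \<inter> A \<subseteq> {z}"
          using e unfolding outer_def by auto
        then obtain t where "e = {z, t}" "t \<noteq> z"
          by (elim edgeE[of e]) blast
        then show ?thesis
          using \<open>e \<in> E\<close> \<open>x \<notin> e\<close> \<open>e \<inter> A \<subseteq> {z}\<close> by auto
      qed
      have "(\<lambda>e. insert x (e - {z})) ` (outer ?A' - outer A) \<subseteq> outer A - outer ?A' - {{x, y}}"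
      proof (rule image_subsetI)
        fix e assume "e \<in> outer ?A' - outer A"
        with new obtain s where s: "e = {z, s}" "{z, s} \<in> E" "s \<notin> A" "s \<noteq> x" by blast
        then have "s \<noteq> z" "insert x (e - {z}) = {x, s}"
          using edgeD by blast+
        moreover have "s \<noteq> y"
          using s(2) zA(3) by (auto simp: insert_commute)
        ultimately show "insert x (e - {z}) \<in> outer A - outer ?A' - {{x, y}}"
          using t[OF s(2,3)] s x unfolding outer_def by (auto simp: doubleton_eq_iff)
      qed
      moreover have "inj_on (\<lambda>e. insert x (e - {z})) (outer ?A' - outer A)"
      proof (rule inj_onI)
        fix e e' assume "e \<in> outer ?A' - outer A" "e' \<in> outer ?A' - outer A"
          and eq: "insert x (e - {z}) = insert x (e' - {z})"
        with new obtain s s' where "e = {z, s}" "s \<noteq> x" "{z, s} \<in> E" "e' = {z, s'}" "s' \<noteq> x" "{z, s'} \<in> E"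
          by metis
        then show "e = e'"
          using eq edgeD[of z s] edgeD[of z s'] by (auto simp: doubleton_eq_iff insert_Diff_if)
      qed
      ultimately have "card (outer ?A' - outer A) \<le> card (outer A - outer ?A' - {{x, y}})"
        using fin_outer by (metis card_inj_on_le finite_Diff)
      also have "\<dots> < card (outer A - outer ?A')"
        by (rule card_Diff1_less) (use xy x y fin_outer in \<open>auto simp: outer_def\<close>)
      finally have "card (outer ?A') < card (outer A)"
        using card_le_sym_Diff[OF fin_outer fin_outer] by (meson not_le)
      then show False
        using least[of ?A'] cl card_cl A x by auto
    qed
    have zw: "{z, w} \<in> E" and xw: "{x, w} \<in> E"
      using A(2) zA(1) w x_adj unfolding clique_def by auto
    have neq: "t \<noteq> x" "t \<noteq> y" "x \<noteq> y" "t \<noteq> z" "t \<noteq> w" "x \<noteq> z" "x \<noteq> w" "y \<noteq> z" "y \<noteq> w"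
      using t zA w x y xy edgeD[OF t(1)] edgeD[OF xy] by (auto simp: insert_commute)
    \<comment> \<open>Otherwise \<open>{z, t}\<close> and \<open>{x, y}\<close> would be independent
      edges. Now \<open>t\<close>, \<open>y\<close>, \<open>x\<close>, \<open>w\<close> is an
      induced 4-cycle if \<open>t\<close> sees \<open>w\<close>; if not, \<open>z\<close> closes it
      to an induced 5-cycle.\<close>
    have ty: "{t, y} \<in> E"
      using no_2K2[of z t x y] t zA xy by (auto simp: insert_commute)
    show False
    proof (cases "{t, w} \<in> E")
      case True
      then show ?thesis
        using no_induced_C4[OF chordal, of t y x w] ty xy xw t w neq by (auto simp: insert_commute)
    next
      case False
      then show ?thesis
        using no_induced_C5[OF chordal, of z t y x w] ty xy xw zw t w zA neq by (auto simp: insert_commute)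
    qed
  qed
  have "indep (V - A) E"
    unfolding indep_def using no_edge nested by (metis edge_commute)
  then show ?thesis
    using that[of A "V - A"] A by blast
qed

text \<open>A vertex of the clique without neighbours in \<open>B\<close> can be moved to
  \<open>B\<close>. One move suffices, because every vertex left in the clique is adjacent to the
  one that was moved.\<close>

lemma split_maximal_indep:
  assumes "A \<union> B = V" "A \<inter> B = {}" "clique A E" "indep B E"
  obtains A' B' where "A' \<union> B' = V" "A' \<inter> B' = {}" "clique A' E" "indep B' E"
    "\<forall>x\<in>A'. \<exists>y\<in>B'. {x, y} \<in> E"
proof (cases "\<forall>x\<in>A. \<exists>y\<in>B. {x, y} \<in> E")
  case True
  then show ?thesis
    using that assms by blast
next
  case False
  then obtain x where x: "x \<in> A" "\<And>y. y \<in> B \<Longrightarrow> {x, y} \<notin> E"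
    by blast
  show ?thesis
  proof (rule that)
    show "(A - {x}) \<union> insert x B = V" "(A - {x}) \<inter> insert x B = {}"
      using assms x by auto
    show "clique (A - {x}) E"
      using assms(3) by (auto simp: clique_def)
    show "indep (insert x B) E"
      using assms(4) x(2) by (auto simp: indep_def insert_commute)
    show "\<forall>y\<in>A - {x}. \<exists>z\<in>insert x B. {y, z} \<in> E"
      using assms(3) x(1) by (auto simp: clique_def)
  qed
qed


section \<open>Minimal vertex covers and Scarf families\<close>

lemma min_cover_imp_vertex_cover: "min_cover V E W \<Longrightarrow> vertex_cover V E W"
  by (simp add: min_cover_def)

lemma min_cover_subset: "min_cover V E W \<Longrightarrow> W \<subseteq> V"
  by (simp add: min_cover_def vertex_cover_def)

lemma finite_min_covers: "finite (Collect (min_cover V E))"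
  by (rule finite_subset[of _ "Pow V"]) (use min_cover_subset finite_V in auto)

lemma finite_scarf_family: "finite (scarf_family V E)"
  by (rule finite_subset[of _ "Pow (Collect (min_cover V E))"])
    (use finite_min_covers in \<open>auto simp: scarf_family_def\<close>)

lemma finite_scarf_edges: "finite (scarf_edges V E)"
  unfolding scarf_edges_def using finite_scarf_family by simp

lemma vertex_cover_edge: "vertex_cover V E W \<Longrightarrow> {x, y} \<in> E \<Longrightarrow> x \<in> W \<or> y \<in> W"
  unfolding vertex_cover_def by (auto dest: bspec[of _ _ "{x, y}"])

lemma vertex_coverI:
  assumes "W \<subseteq> V" and cover: "\<And>x y. {x, y} \<in> E \<Longrightarrow> x \<notin> W \<Longrightarrow> y \<notin> W \<Longrightarrow> False"
  shows "vertex_cover V E W"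
  unfolding vertex_cover_def
proof (intro conjI ballI assms(1))
  fix e assume "e \<in> E"
  moreover from this obtain x y where "e = {x, y}"
    by (rule edgeE)
  ultimately show "W \<inter> e \<noteq> {}"
    using cover[of x y] by auto
qed

lemma min_cover_below:
  assumes "vertex_cover V E W"
  obtains W' where "min_cover V E W'" "W' \<subseteq> W"
proof -
  let ?S = "{W'. vertex_cover V E W' \<and> W' \<subseteq> W}"
  have "?S \<subseteq> Pow V"
    by (auto simp: vertex_cover_def)
  then have "finite ?S"
    using finite_V finite_subset by blast
  moreover have "?S \<noteq> {}"
    using assms by blast
  ultimately have "\<exists>m\<in>?S. \<forall>b\<in>?S. b \<subseteq> m \<longrightarrow> m = b"
    by (rule finite_has_minimal)
  then
  obtain W' where W': "W' \<in> ?S" "\<forall>W''\<in>?S. W'' \<subseteq> W' \<longrightarrow> W' = W''" ..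
  then have "min_cover V E W'"
    unfolding min_cover_def by blast
  with W'(1) show ?thesis
    using that by blast
qed

text \<open>The complement of an independent set is a vertex cover. This is the source of covers
  with prescribed omissions, that is, of generators not divisible by given variables.\<close>

lemma min_cover_avoiding:
  assumes "indep C E"
  obtains W where "min_cover V E W" "W \<inter> C = {}"
proof -
  have "vertex_cover V E (V - C)"
    by (rule vertex_coverI) (use assms edgeD in \<open>auto simp: indep_def\<close>)
  then show ?thesis
    using that by (elim min_cover_below) blast
qed

text \<open>A cover inside \<open>W\<close> has to keep every \<open>x\<close> with a neighbour
  outside \<open>W\<close>, since it cannot meet that edge at the other end.\<close>

lemma min_cover_eqI:
  assumes "vertex_cover V E W" and "\<And>x. x \<in> W \<Longrightarrow> \<exists>y. {x, y} \<in> E \<and> y \<notin> W"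
  shows "min_cover V E W"
  unfolding min_cover_def
proof (intro conjI allI impI assms(1))
  fix W' assume W': "vertex_cover V E W' \<and> W' \<subseteq> W"
  show "W' = W"
  proof (intro equalityI subsetI)
    fix x assume "x \<in> W"
    with assms(2) obtain y where "{x, y} \<in> E" "y \<notin> W" by blast
    then show "x \<in> W'"
      using W' vertex_cover_edge by blast
  qed (use W' in blast)
qed

text \<open>For each pair in the triple choose a vertex that only the third cover contains. These three
  vertices are independent, and a minimal cover avoiding them would enlarge the triple.\<close>

lemma no_scarf_triple:
  assumes "\<W> \<in> scarf_family V E" "card \<W> = 3"
  shows False
proof -
  obtain W1 W2 W3 where W: "\<W> = {W1, W2, W3}" "W1 \<noteq> W2" "W1 \<noteq> W3" "W2 \<noteq> W3"
    using assms(2) by (auto simp: card_3_iff)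
  have mc: "min_cover V E W1" "min_cover V E W2" "min_cover V E W3"
    using assms(1) W unfolding scarf_family_def by auto
  have unique: "\<T> = \<W>" if "\<T> \<subseteq> Collect (min_cover V E)" "\<Union>\<T> = \<Union>\<W>" for \<T>
    using assms(1) that unfolding scarf_family_def by blast
  have "\<Union>{W1, W2} \<noteq> \<Union>\<W>" "\<Union>{W1, W3} \<noteq> \<Union>\<W>" "\<Union>{W2, W3} \<noteq> \<Union>\<W>"
    using unique[of "{W1, W2}"] unique[of "{W1, W3}"] unique[of "{W2, W3}"] mc W by auto
  then obtain x12 x13 x23 where x: "x12 \<in> W3 - W1 - W2" "x13 \<in> W2 - W1 - W3" "x23 \<in> W1 - W2 - W3"
    unfolding W(1) by (auto simp: set_eq_iff)
  \<comment> \<open>The part \<open>V - \<Union>\<W>\<close> confines a cover avoiding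
    \<open>?C\<close> to the union of the triple, so that adjoining it leaves the union unchanged.
    Independence holds because any two elements of \<open>?C\<close> are missed by a common cover of
    the triple; for \<open>x12\<close> and \<open>x13\<close> this is \<open>W1\<close>.\<close>
  let ?C = "insert x12 (insert x13 (insert x23 (V - \<Union>\<W>)))"
  have "indep ?C E"
    unfolding indep_def
  proof (intro ballI impI)
    fix u v assume uv: "u \<in> ?C" "v \<in> ?C" "u \<noteq> v"
    then have "u \<notin> W1 \<and> v \<notin> W1 \<or> u \<notin> W2 \<and> v \<notin> W2 \<or> u \<notin> W3 \<and> v \<notin> W3"
      using x unfolding W(1) by auto
    then show "{u, v} \<notin> E"
      using mc[THEN min_cover_imp_vertex_cover] vertex_cover_edge by blast
  qed
  then obtain W4 where W4: "min_cover V E W4" "W4 \<inter> ?C = {}"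
    by (rule min_cover_avoiding)
  then have "W4 \<subseteq> \<Union>\<W>"
    using min_cover_subset[OF W4(1)] by blast
  then have "insert W4 \<W> = \<W>"
    by (intro unique) (use W4(1) mc W(1) in auto)
  then have "W4 \<in> {W1, W2, W3}"
    using W(1) by blast
  then show False
    using W4(2) x by blast
qed

text \<open>A cover that omits \<open>a\<close> in \<open>A\<close> contains all neighbours of
  \<open>a\<close>, namely \<open>A - {a}\<close> and those in \<open>B\<close>, and these already
  form a cover. Minimality of \<open>A\<close> itself is where \<open>dom\<close> enters: each of
  its vertices has a neighbour outside.\<close>

lemma split_min_covers:
  assumes split: "A \<union> B = V" "A \<inter> B = {}" "clique A E" "indep B E"
    and dom: "\<forall>x\<in>A. \<exists>y\<in>B. {x, y} \<in> E"
  shows "Collect (min_cover V E) = insert A ((\<lambda>a. A - {a} \<union> nbhd V E a \<inter> B) ` A)"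
proof (intro equalityI subsetI)
  let ?W = "\<lambda>a. A - {a} \<union> nbhd V E a \<inter> B"
  have A: "vertex_cover V E A"
    by (rule vertex_coverI) (use split edgeD in \<open>auto simp: indep_def, blast\<close>)
  have Wa: "vertex_cover V E (?W a)" if "a \<in> A" for a
  proof (rule vertex_coverI)
    show "?W a \<subseteq> V"
      using split(1) by auto
    fix x y assume xy: "{x, y} \<in> E" "x \<notin> ?W a" "y \<notin> ?W a"
    then have "x \<notin> B \<or> y \<notin> B" "x \<noteq> y" "x \<in> V" "y \<in> V"
      using split(4) edgeD[OF xy(1)] unfolding indep_def by auto
    then consider "x = a" "y \<in> B" | "y = a" "x \<in> B"
      using xy split(1) by blast
    then show False
      using xy \<open>x \<in> V\<close> \<open>y \<in> V\<close> by cases (auto simp: nbhd_def insert_commute)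
  qed
  have mA: "min_cover V E A"
    by (rule min_cover_eqI[OF A]) (use dom split(2) in blast)
  have mWa: "min_cover V E (?W a)" if "a \<in> A" for a
  proof (rule min_cover_eqI[OF Wa[OF that]])
    fix x assume "x \<in> ?W a"
    then have "{x, a} \<in> E"
      using split(3) that by (auto simp: clique_def nbhd_def insert_commute)
    moreover have "a \<notin> ?W a"
      using that split(2) by auto
    ultimately show "\<exists>y. {x, y} \<in> E \<and> y \<notin> ?W a" by blast
  qed
  fix W
  show "W \<in> insert A (?W ` A)" if "W \<in> Collect (min_cover V E)"
  proof (cases "A \<subseteq> W")
    case True
    then show ?thesis
      using that A by (auto simp: min_cover_def)
  next
    case False
    then obtain a where a: "a \<in> A" "a \<notin> W" by blast
    have "?W a \<subseteq> W"
    proof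
      fix x assume "x \<in> ?W a"
      then have "{a, x} \<in> E"
        using split(3) a by (auto simp: clique_def nbhd_def)
      then show "x \<in> W"
        using that a vertex_cover_edge by (auto simp: min_cover_def)
    qed
    then have "?W a = W"
      using that Wa[OF a(1)] by (auto simp: min_cover_def)
    then show ?thesis
      using a(1) by blast
  qed
  show "W \<in> Collect (min_cover V E)" if "W \<in> insert A (?W ` A)"
    using that mA mWa by auto
qed


lemma scarf_edgeE:
  assumes "\<W> \<in> scarf_edges V E"
  obtains W1 W2 where "\<W> = {W1, W2}" "W1 \<noteq> W2" "min_cover V E W1" "min_cover V E W2"
  using assms by (auto simp: scarf_edges_def scarf_family_def card_2_iff)

lemma scarf_edge_containingE:
  assumes "\<W> \<in> scarf_edges V E" "W \<in> \<W>"
  obtains W' where "\<W> = {W, W'}" "W' \<noteq> W" "min_cover V E W'"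
proof -
  obtain W1 W2 where W: "\<W> = {W1, W2}" "W1 \<noteq> W2" "min_cover V E W1" "min_cover V E W2"
    using assms(1) by (rule scarf_edgeE)
  with assms(2) consider "W = W1" | "W = W2"
    by blast
  then show ?thesis
  proof cases
    case 1
    then show ?thesis
      using W that[of W2] by simp
  next
    case 2
    then show ?thesis
      using W that[of W1] by (simp add: insert_commute)
  qed
qed

lemma scarf_family_unique:
  "\<W> \<in> scarf_family V E \<Longrightarrow> \<T> \<subseteq> Collect (min_cover V E) \<Longrightarrow> \<Union>\<T> = \<Union>\<W> \<Longrightarrow> \<T> = \<W>"
  by (simp add: scarf_family_def)

text \<open>For distinct \<open>a\<close> and \<open>b\<close>, the cover obtained from
  \<open>a\<close> contains \<open>A - {a}\<close> and that from \<open>b\<close> contains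
  \<open>a\<close>. Their union therefore includes \<open>A\<close>, which could be adjoined to the
  pair without changing the union.\<close>

lemma split_scarf_edge:
  assumes split: "A \<union> B = V" "A \<inter> B = {}" "clique A E" "indep B E"
    and dom: "\<forall>x\<in>A. \<exists>y\<in>B. {x, y} \<in> E"
    and \<W>: "\<W> \<in> scarf_edges V E"
  shows "A \<in> \<W>"
proof (rule ccontr)
  assume A: "A \<notin> \<W>"
  let ?W = "\<lambda>a. A - {a} \<union> nbhd V E a \<inter> B"
  obtain W1 W2 where W: "\<W> = {W1, W2}" "W1 \<noteq> W2" "min_cover V E W1" "min_cover V E W2"
    using \<W> by (rule scarf_edgeE)
  have "W1 \<in> insert A (?W ` A)" "W2 \<in> insert A (?W ` A)"
    unfolding split_min_covers[OF split dom, symmetric] using W(3,4) by simp_all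
  then have "W1 \<in> ?W ` A" "W2 \<in> ?W ` A"
    using A W(1) by (metis insertCI insertE)+
  then obtain a b where ab: "a \<in> A" "W1 = ?W a" "b \<in> A" "W2 = ?W b"
    by (elim imageE)
  then have "a \<noteq> b"
    using W(2) by metis
  have "insert A \<W> = \<W>"
  proof (rule scarf_family_unique)
    show "\<W> \<in> scarf_family V E"
      using \<W> by (simp add: scarf_edges_def)
    have "A \<in> Collect (min_cover V E)"
      unfolding split_min_covers[OF split dom] by (rule insertI1)
    then show "insert A \<W> \<subseteq> Collect (min_cover V E)"
      using W by simp
    show "\<Union>(insert A \<W>) = \<Union>\<W>"
      unfolding W(1) ab using \<open>a \<noteq> b\<close> by auto
  qed
  then show False
    using A by (metis insertI1)
qed

section \<open>Signed chains on the graph of Scarf pairs\<close>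

context
  fixes s :: "'v set set \<Rightarrow> 'v set \<Rightarrow> 'k::field"
  assumes sign: "\<lbrakk>min_cover V E W1; min_cover V E W2; W1 \<noteq> W2\<rbrakk> \<Longrightarrow> s {W1, W2} W1 = - s {W1, W2} W2"
    and connected: "\<lbrakk>min_cover V E W1; min_cover V E W2; W1 \<inter> U = {}; W2 \<inter> U = {}\<rbrakk> \<Longrightarrow>
      \<exists>f. (\<forall>\<W>. f \<W> \<noteq> 0 \<longrightarrow> \<Union>\<W> \<inter> U = {}) \<and>
        (\<forall>W. min_cover V E W \<longrightarrow> scarf_boundary V E s f W = of_bool (W = W1) - of_bool (W = W2))"
begin

text \<open>Paths in the Scarf graph avoiding \<open>a\<close>, \<open>d\<close>, \<open>b\<close>, \<open>c\<close> in turn close up to a cycle through covers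
  that avoid \<open>{a, d}\<close>, \<open>{b, d}\<close>, \<open>{b, c}\<close>, \<open>{a, c}\<close>. The cycle is nonzero: restrict it to the edges
  avoiding \<open>a\<close>, and sum the boundary over the covers avoiding \<open>c\<close>.\<close>

lemma no_2K2_of_scarf_tree:
  assumes acyclic: "\<forall>f. (\<forall>W. min_cover V E W \<longrightarrow> scarf_boundary V E s f W = 0) \<longrightarrow>
      (\<forall>\<W>\<in>scarf_edges V E. f \<W> = 0)"
    and ab: "{a, b} \<in> E" and cd: "{c, d} \<in> E"
    and nonedges: "{a, c} \<notin> E" "{a, d} \<notin> E" "{b, c} \<notin> E" "{b, d} \<notin> E"
  shows False
proof -
  let ?M = "Collect (min_cover V E)"
  have avoid: "\<exists>W. min_cover V E W \<and> x \<notin> W \<and> y \<notin> W" if "{x, y} \<notin> E" for x y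
  proof -
    have "indep {x, y} E"
      using that by (auto simp: indep_def insert_commute)
    then show ?thesis
      by (rule min_cover_avoiding) blast
  qed
  obtain Wac where ac: "min_cover V E Wac" "a \<notin> Wac" "c \<notin> Wac"
    using avoid[OF nonedges(1)] by blast
  obtain Wad where ad: "min_cover V E Wad" "a \<notin> Wad" "d \<notin> Wad"
    using avoid[OF nonedges(2)] by blast
  obtain Wbc where bc: "min_cover V E Wbc" "b \<notin> Wbc" "c \<notin> Wbc"
    using avoid[OF nonedges(3)] by blast
  obtain Wbd where bd: "min_cover V E Wbd" "b \<notin> Wbd" "d \<notin> Wbd"
    using avoid[OF nonedges(4)] by blast
  have path: "\<exists>f. (\<forall>\<W>. f \<W> \<noteq> 0 \<longrightarrow> x \<notin> \<Union>\<W>) \<and>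
      (\<forall>W. min_cover V E W \<longrightarrow> scarf_boundary V E s f W = of_bool (W = W1) - of_bool (W = W2))"
    if "min_cover V E W1" "min_cover V E W2" "x \<notin> W1" "x \<notin> W2" for x W1 W2
    using connected[of W1 W2 "{x}"] that by simp
  obtain fa where fa: "\<And>\<W>. fa \<W> \<noteq> 0 \<Longrightarrow> a \<notin> \<Union>\<W>"
    "\<And>W. min_cover V E W \<Longrightarrow> scarf_boundary V E s fa W = of_bool (W = Wad) - of_bool (W = Wac)"
    using path[OF ad(1) ac(1) ad(2) ac(2)] by blast
  obtain fb where fb: "\<And>\<W>. fb \<W> \<noteq> 0 \<Longrightarrow> b \<notin> \<Union>\<W>"
    "\<And>W. min_cover V E W \<Longrightarrow> scarf_boundary V E s fb W = of_bool (W = Wbc) - of_bool (W = Wbd)"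
    using path[OF bc(1) bd(1) bc(2) bd(2)] by blast
  obtain fc where fc: "\<And>\<W>. fc \<W> \<noteq> 0 \<Longrightarrow> c \<notin> \<Union>\<W>"
    "\<And>W. min_cover V E W \<Longrightarrow> scarf_boundary V E s fc W = of_bool (W = Wac) - of_bool (W = Wbc)"
    using path[OF ac(1) bc(1) ac(3) bc(3)] by blast
  obtain fd where fd: "\<And>\<W>. fd \<W> \<noteq> 0 \<Longrightarrow> d \<notin> \<Union>\<W>"
    "\<And>W. min_cover V E W \<Longrightarrow> scarf_boundary V E s fd W = of_bool (W = Wbd) - of_bool (W = Wad)"
    using path[OF bd(1) ad(1) bd(3) ad(3)] by blast
  \<comment> \<open>No cover omits both ends of an edge. So a pair supporting \<open>fb\<close>
    contains \<open>a\<close> in its union and is cut off by the first condition, and a cover in a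
    pair supporting \<open>fd\<close> contains \<open>c\<close>. On \<open>fc\<close> the condition
    on \<open>c\<close> is automatic, so both ends of each remaining pair are counted and their
    signs cancel.\<close>
  define \<Phi> where "\<Phi> g = (\<Sum>\<W>\<in>scarf_edges V E. \<Sum>W\<in>?M.
      if a \<notin> \<Union>\<W> \<and> W \<in> \<W> \<and> c \<notin> W then s \<W> W * g \<W> else 0)" for g :: "'v set set \<Rightarrow> 'k"
  have cover_ab: "a \<in> W \<or> b \<in> W" and cover_cd: "c \<in> W \<or> d \<in> W" if "min_cover V E W" for W
    using that ab cd vertex_cover_edge min_cover_imp_vertex_cover by blast+
  let ?g = "\<lambda>\<W>. fa \<W> + fb \<W> + fc \<W> + fd \<W>"
  have g0: "\<forall>\<W>\<in>scarf_edges V E. ?g \<W> = 0"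
  proof (rule acyclic[THEN spec[of _ ?g], THEN mp], intro allI impI)
    fix W assume W: "min_cover V E W"
    have "scarf_boundary V E s ?g W = scarf_boundary V E s fa W + scarf_boundary V E s fb W
        + scarf_boundary V E s fc W + scarf_boundary V E s fd W"
      unfolding scarf_boundary_def by (simp add: distrib_left sum.distrib)
    then show "scarf_boundary V E s ?g W = 0"
      using fa(2)[OF W] fb(2)[OF W] fc(2)[OF W] fd(2)[OF W] by simp
  qed
  have "\<Phi> ?g = \<Phi> fa + \<Phi> fb + \<Phi> fc + \<Phi> fd"
    unfolding \<Phi>_def sum.distrib[symmetric] by (intro sum.cong refl) (simp add: distrib_left)
  moreover have "\<Phi> ?g = 0"
    unfolding \<Phi>_def by (intro sum.neutral ballI) (simp add: g0)
  moreover have "\<Phi> fb = 0"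
    unfolding \<Phi>_def
  proof (intro sum.neutral ballI)
    fix \<W> W assume "W \<in> ?M"
    then show "(if a \<notin> \<Union>\<W> \<and> W \<in> \<W> \<and> c \<notin> W then s \<W> W * fb \<W> else 0) = 0"
      using fb(1)[of \<W>] cover_ab[of W] by auto
  qed
  moreover have "\<Phi> fd = 0"
    unfolding \<Phi>_def
  proof (intro sum.neutral ballI)
    fix \<W> W assume "W \<in> ?M"
    then show "(if a \<notin> \<Union>\<W> \<and> W \<in> \<W> \<and> c \<notin> W then s \<W> W * fd \<W> else 0) = 0"
      using fd(1)[of \<W>] cover_cd[of W] by auto
  qed
  moreover have "\<Phi> fc = 0"
    unfolding \<Phi>_def
  proof (rule sum.neutral, rule ballI)
    fix \<W> assume "\<W> \<in> scarf_edges V E"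
    then obtain W1 W2 where W: "\<W> = {W1, W2}" "W1 \<noteq> W2" "min_cover V E W1" "min_cover V E W2"
      by (rule scarf_edgeE)
    show "(\<Sum>W\<in>?M. if a \<notin> \<Union>\<W> \<and> W \<in> \<W> \<and> c \<notin> W then s \<W> W * fc \<W> else 0) = 0"
    proof (cases "fc \<W> = 0 \<or> a \<in> \<Union>\<W>")
      case True
      then show ?thesis
        by (intro sum.neutral) auto
    next
      case False
      then have "(\<Sum>W\<in>?M. if a \<notin> \<Union>\<W> \<and> W \<in> \<W> \<and> c \<notin> W then s \<W> W * fc \<W> else 0)
          = (\<Sum>W\<in>?M. if W \<in> \<W> then s \<W> W * fc \<W> else 0)"
        using fc(1)[of \<W>] by (intro sum.cong) auto
      also have "\<dots> = (\<Sum>W\<in>\<W>. s \<W> W * fc \<W>)"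
        using W finite_min_covers by (subst sum.inter_restrict[symmetric]) (auto intro: sum.cong)
      also have "\<dots> = 0"
        using sign[OF W(3,4,2)] W by simp
      finally show ?thesis .
    qed
  qed
  \<comment> \<open>The condition on \<open>a\<close> is automatic here, so the sum is the boundary
    of \<open>fa\<close> over the covers omitting \<open>c\<close>. Of the two covers in this
    boundary, \<open>Wad\<close> omits \<open>d\<close> and so contains \<open>c\<close>, which
    leaves \<open>Wac\<close> with coefficient -1.\<close>
  moreover have "\<Phi> fa = -1"
  proof -
    have "\<Phi> fa = (\<Sum>\<W>\<in>scarf_edges V E. \<Sum>W\<in>?M. if W \<in> \<W> \<and> c \<notin> W then s \<W> W * fa \<W> else 0)"
      unfolding \<Phi>_def using fa(1) by (intro sum.cong refl) auto
    also have "\<dots> = (\<Sum>W\<in>?M. \<Sum>\<W>\<in>scarf_edges V E. if W \<in> \<W> \<and> c \<notin> W then s \<W> W * fa \<W> else 0)"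
      by (rule sum.swap)
    also have "\<dots> = (\<Sum>W\<in>?M. if c \<notin> W then scarf_boundary V E s fa W else 0)"
      unfolding scarf_boundary_def using finite_scarf_edges
      by (intro sum.cong refl) (simp add: sum.inter_filter)
    also have "\<dots> = (\<Sum>W\<in>?M. if W = Wac then -1 else 0)"
      using fa(2) ac ad cover_cd[OF ad(1)] by (intro sum.cong refl) auto
    also have "\<dots> = -1"
      using ac(1) finite_min_covers by simp
    finally show ?thesis .
  qed
  ultimately show False
    by simp
qed

lemma partition_of_scarf_tree:
  assumes acyclic: "\<forall>f. (\<forall>W. min_cover V E W \<longrightarrow> scarf_boundary V E s f W = 0) \<longrightarrow>
      (\<forall>\<W>\<in>scarf_edges V E. f \<W> = 0)"
    and chordal: "chordal V E"
  shows "\<exists>A B. A \<union> B = V \<and> A \<inter> B = {} \<and> clique A E \<and> indep B E \<and>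
       (\<forall>x\<in>A. \<exists>y\<in>B. {x, y} \<in> E) \<and>
       (\<forall>x\<in>A. \<forall>x'\<in>A. x \<noteq> x' \<longrightarrow> \<not> nbhd V E x \<inter> B \<subseteq> nbhd V E x' \<inter> B)"
proof -
  obtain A0 B0 where "A0 \<union> B0 = V" "A0 \<inter> B0 = {}" "clique A0 E" "indep B0 E"
    by (rule split_of_no_2K2[OF chordal no_2K2_of_scarf_tree[OF acyclic]])
  then obtain A B where split: "A \<union> B = V" "A \<inter> B = {}" "clique A E" "indep B E"
    and dom: "\<forall>x\<in>A. \<exists>y\<in>B. {x, y} \<in> E"
    by (rule split_maximal_indep)
  let ?W = "\<lambda>a. A - {a} \<union> nbhd V E a \<inter> B"
  have covers: "min_cover V E W \<longleftrightarrow> W \<in> insert A (?W ` A)" for W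
    using split_min_covers[OF split dom] by (simp only: set_eq_iff mem_Collect_eq)
  then have cover_A: "min_cover V E A" and cover_W: "\<And>a. a \<in> A \<Longrightarrow> min_cover V E (?W a)"
    by simp_all
  have "\<not> nbhd V E x \<inter> B \<subseteq> nbhd V E x' \<inter> B" if x: "x \<in> A" "x' \<in> A" "x \<noteq> x'" for x x'
  proof
    assume sub: "nbhd V E x \<inter> B \<subseteq> nbhd V E x' \<inter> B"
    have W_ne: "?W a \<noteq> A" if "a \<in> A" for a
      using that split(2) by auto
    \<comment> \<open>A Scarf pair through \<open>?W x'\<close> must be \<open>{?W x', A}\<close>.
      By the inclusion \<open>sub\<close>, the cover \<open>?W x\<close> lies in its union, so the
      pair is not determined by its union.\<close>
    have no_edge: "?W x' \<notin> \<W>" if \<W>: "\<W> \<in> scarf_edges V E" for \<W>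
    proof
      assume "?W x' \<in> \<W>"
      with \<W> obtain W where W: "\<W> = {?W x', W}" "W \<noteq> ?W x'" "min_cover V E W"
        by (rule scarf_edge_containingE)
      have "A \<in> \<W>"
        by (rule split_scarf_edge[OF split dom \<W>])
      then have \<W>_eq: "\<W> = {?W x', A}"
        using W W_ne[OF x(2)] by auto
      have "insert (?W x) \<W> = \<W>"
      proof (rule scarf_family_unique)
        show "\<W> \<in> scarf_family V E"
          using \<W> by (simp add: scarf_edges_def)
      qed (use \<W>_eq cover_A cover_W x sub in auto)
      then have "?W x \<in> {?W x', A}"
        unfolding \<W>_eq by (metis insertI1)
      moreover have "?W x \<noteq> ?W x'"
        using x split(2) by auto
      ultimately show False
        using W_ne[OF x(1)] by (metis empty_iff insert_iff)
    qed
    \<comment> \<open>Connectedness with empty \<open>U\<close> asks for a chain with boundary -1 at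
      \<open>?W x'\<close>, but the boundary there is an empty sum.\<close>
    obtain f where "\<And>W. min_cover V E W \<Longrightarrow>
        scarf_boundary V E s f W = of_bool (W = A) - of_bool (W = ?W x')"
      using connected[OF cover_A cover_W[OF x(2)], of "{}"] by auto
    from this[OF cover_W[OF x(2)]] have "scarf_boundary V E s f (?W x') = -1"
      using W_ne[OF x(2)] by simp
    moreover have "scarf_boundary V E s f (?W x') = 0"
      unfolding scarf_boundary_def using no_edge by (intro sum.neutral) blast
    ultimately show False
      by simp
  qed
  with split dom show ?thesis
    by blast
qed

end

end


section \<open>Monomials and the cover ideal\<close>

lemma lookup_single_mult [simp]:
  fixes p :: "('v, 'k::field) mpoly"
  shows "Poly_Mapping.lookup (Poly_Mapping.single m c * p) (m + n) = c * Poly_Mapping.lookup p n"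
proof -
  have "Poly_Mapping.lookup (Poly_Mapping.single m c * p) (m + n)
      = (\<Sum>l. (c * (\<Sum>q. Poly_Mapping.lookup p q when m + n = l + q)) when l = m)"
    unfolding lookup_mult by (intro Sum_any.cong) (auto simp: lookup_single when_def)
  also have "\<dots> = c * (\<Sum>q. Poly_Mapping.lookup p q when q = n)"
    by (simp add: eq_commute[of n])
  finally show ?thesis
    by simp
qed

lemma lookup_single_mult_eq_0:
  fixes p :: "('v, 'k::field) mpoly"
  assumes "\<And>n. k \<noteq> m + n"
  shows "Poly_Mapping.lookup (Poly_Mapping.single m c * p) k = 0"
proof -
  have "k \<notin> Poly_Mapping.keys (Poly_Mapping.single m c * p)"
    using keys_mult[of "Poly_Mapping.single m c" p] assms by (auto split: if_splits)
  then show ?thesis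
    by (simp add: in_keys_iff)
qed

lemma poly_mapping_sum_single:
  "(\<Sum>m\<in>Poly_Mapping.keys p. Poly_Mapping.single m (Poly_Mapping.lookup p m)) = p"
  by (rule poly_mapping_eqI) (auto simp: lookup_sum lookup_single when_def in_keys_iff)

lemma keys_plus_mon: "Poly_Mapping.keys (m + n) = Poly_Mapping.keys m \<union> Poly_Mapping.keys n" for m n :: "'v mon"
  by (auto simp: in_keys_iff lookup_add)

lemma mon_dvd_iff: "mon_dvd m n \<longleftrightarrow> (\<forall>x. Poly_Mapping.lookup m x \<le> Poly_Mapping.lookup n x)"
proof
  assume "\<forall>x. Poly_Mapping.lookup m x \<le> Poly_Mapping.lookup n x"
  then have "n = m + (n - m)"
    by (intro poly_mapping_eqI) (simp add: lookup_add lookup_minus)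
  then show "mon_dvd m n"
    unfolding mon_dvd_def by blast
qed (auto simp: mon_dvd_def lookup_add)

text \<open>The exponent vector of the product of the variables in \<open>W\<close>.
  \<open>Abs_poly_mapping\<close> is meaningful only for functions of finite support, whence the
  finiteness premises in the rules that follow.\<close>

definition sqfree :: "'v set \<Rightarrow> 'v mon" where
  "sqfree W = Abs_poly_mapping (\<lambda>x. of_bool (x \<in> W))"

lemma lookup_sqfree [simp]: "finite W \<Longrightarrow> Poly_Mapping.lookup (sqfree W) x = of_bool (x \<in> W)"
  unfolding sqfree_def by (subst lookup_Abs_poly_mapping) auto

lemma keys_sqfree [simp]: "finite W \<Longrightarrow> Poly_Mapping.keys (sqfree W) = W"
  by (auto simp: in_keys_iff)

lemma sqfree_empty [simp]: "sqfree {} = 0"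
  by (simp add: sqfree_def)

lemma sqfree_inj [simp]: "finite W \<Longrightarrow> finite W' \<Longrightarrow> sqfree W = sqfree W' \<longleftrightarrow> W = W'"
  by (metis keys_sqfree)

lemma sqfree_Un: "finite W \<Longrightarrow> finite W' \<Longrightarrow> W \<inter> W' = {} \<Longrightarrow> sqfree (W \<union> W') = sqfree W + sqfree W'"
  by (intro poly_mapping_eqI) (auto simp: lookup_add)

lemma sqfree_add_Diff: "finite W' \<Longrightarrow> W \<subseteq> W' \<Longrightarrow> sqfree W + sqfree (W' - W) = sqfree W'"
  using sqfree_Un[of W "W' - W"] finite_subset[of W W'] by (simp add: Un_absorb1)

lemma sqfree_minus: "finite W \<Longrightarrow> finite W' \<Longrightarrow> sqfree W - sqfree W' = sqfree (W - W')"
  by (intro poly_mapping_eqI) (auto simp: lookup_minus)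

lemma sqfree_keys_dvd: "mon_dvd (sqfree (Poly_Mapping.keys m)) m"
  by (auto simp: mon_dvd_iff in_keys_iff Suc_leI)

text \<open>A maximum of indicator values is the indicator of the union; the 0 inserted into the
  maximum accounts for the empty family and for variables that occur in no member.\<close>

lemma mon_lcm_sqfree:
  assumes "finite \<W>" "\<And>W. W \<in> \<W> \<Longrightarrow> finite W"
  shows "mon_lcm (sqfree ` \<W>) = sqfree (\<Union>\<W>)"
proof -
  have "Max (insert 0 ((\<lambda>m. Poly_Mapping.lookup m x) ` sqfree ` \<W>)) = of_bool (x \<in> \<Union>\<W>)" for x
  proof (rule Max_eqI)
    show "of_bool (x \<in> \<Union>\<W>) \<in> insert 0 ((\<lambda>m. Poly_Mapping.lookup m x) ` sqfree ` \<W>)"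
    proof (cases "x \<in> \<Union>\<W>")
      case True
      then obtain W where "W \<in> \<W>" "x \<in> W" by blast
      then have "Poly_Mapping.lookup (sqfree W) x = of_bool (x \<in> \<Union>\<W>)"
        using assms(2) by auto
      then show ?thesis
        using \<open>W \<in> \<W>\<close> by (metis image_eqI insertI2)
    qed simp
  qed (use assms in auto)
  then show ?thesis
    unfolding mon_lcm_def sqfree_def[of "\<Union>\<W>"] by simp
qed

lemma prod_var: "finite W \<Longrightarrow> (\<Prod>x\<in>W. var x) = (Poly_Mapping.single (sqfree W) 1 :: ('v, 'k::field) mpoly)"
proof (induction W rule: finite_induct)
  case (insert x W)
  then have "sqfree (insert x W) = Poly_Mapping.single x 1 + sqfree W"
    by (intro poly_mapping_eqI) (auto simp: lookup_add lookup_single when_def)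
  then show ?case
    using insert by (simp add: var_def mult_single)
qed simp

section \<open>Polynomials in the variables \<open>V\<close> and their monomial ideals\<close>

lemma poly_ring_simps [simp]:
  "p \<in> carrier (poly_ring V) \<longleftrightarrow> (\<forall>m\<in>Poly_Mapping.keys p. Poly_Mapping.keys m \<subseteq> V)"
  "p \<otimes>\<^bsub>poly_ring V\<^esub> q = p * q" "\<one>\<^bsub>poly_ring V\<^esub> = 1"
  "\<zero>\<^bsub>poly_ring V\<^esub> = 0" "p \<oplus>\<^bsub>poly_ring V\<^esub> q = p + q"
  by (simp_all add: poly_ring_def)

lemma poly_carrier_add: "p \<in> carrier (poly_ring V) \<Longrightarrow> q \<in> carrier (poly_ring V) \<Longrightarrow> p + q \<in> carrier (poly_ring V)"
  using keys_add[of p q] by fastforce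

lemma poly_carrier_mult: "p \<in> carrier (poly_ring V) \<Longrightarrow> q \<in> carrier (poly_ring V) \<Longrightarrow> p * q \<in> carrier (poly_ring V)"
  using keys_mult[of p q] by (fastforce simp: keys_plus_mon)

lemma keys_uminus_poly [simp]: "Poly_Mapping.keys (- p) = Poly_Mapping.keys p" for p :: "('v, 'k::field) mpoly"
  by (auto simp: in_keys_iff)

lemma poly_carrier_diff: "p \<in> carrier (poly_ring V) \<Longrightarrow> q \<in> carrier (poly_ring V) \<Longrightarrow> p - q \<in> carrier (poly_ring V)"
  for p q :: "('v, 'k::field) mpoly"
  using poly_carrier_add[of p V "- q"] by simp

lemma cring_poly_ring: "cring (poly_ring V :: ('v, 'k::field) mpoly ring)"
proof (rule cringI)
  show "abelian_group (poly_ring V :: ('v, 'k) mpoly ring)"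
  proof (rule abelian_groupI)
    fix p :: "('v, 'k) mpoly" assume "p \<in> carrier (poly_ring V)"
    then show "\<exists>q\<in>carrier (poly_ring V). q \<oplus>\<^bsub>poly_ring V\<^esub> p = \<zero>\<^bsub>poly_ring V\<^esub>"
      by (intro bexI[of _ "- p"]) auto
  next
    fix p q :: "('v, 'k) mpoly" assume "p \<in> carrier (poly_ring V)" "q \<in> carrier (poly_ring V)"
    then show "p \<oplus>\<^bsub>poly_ring V\<^esub> q \<in> carrier (poly_ring V)"
      using poly_carrier_add by (simp del: poly_ring_simps(1))
  qed (simp_all add: add_ac)
  show "Group.comm_monoid (poly_ring V :: ('v, 'k) mpoly ring)"
  proof (rule comm_monoidI)
    fix p q :: "('v, 'k) mpoly" assume "p \<in> carrier (poly_ring V)" "q \<in> carrier (poly_ring V)"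
    then show "p \<otimes>\<^bsub>poly_ring V\<^esub> q \<in> carrier (poly_ring V)"
      using poly_carrier_mult by (simp del: poly_ring_simps(1))
  qed (simp_all add: mult_ac)
qed (simp add: distrib_right)

lemma ring_poly_ring: "ring (poly_ring V :: ('v, 'k::field) mpoly ring)"
  using cring_poly_ring cring.axioms(1) by blast

lemma poly_ring_a_inv: "p \<in> carrier (poly_ring V) \<Longrightarrow> \<ominus>\<^bsub>poly_ring V\<^esub> p = - p" for p :: "('v, 'k::field) mpoly"
  using abelian_group.minus_equality[OF ring.is_abelian_group[OF ring_poly_ring], where x = p and y = "- p"] by simp

lemma ideal_poly_sum:
  assumes "ideal I (poly_ring V :: ('v, 'k::field) mpoly ring)" "\<And>x. x \<in> A \<Longrightarrow> f x \<in> I"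
  shows "sum f A \<in> I"
  using assms(2)
proof (induction A rule: infinite_finite_induct)
  case (insert x A)
  then show ?case
    using additive_subgroup.a_closed[OF ideal.axioms(1)[OF assms(1)]] by fastforce
qed (use additive_subgroup.zero_closed[OF ideal.axioms(1)[OF assms(1)]] in auto)

lemma ideal_poly_mult:
  "ideal I (poly_ring V :: ('v, 'k::field) mpoly ring) \<Longrightarrow> p \<in> carrier (poly_ring V) \<Longrightarrow> q \<in> I \<Longrightarrow> p * q \<in> I"
  using ideal.I_l_closed by fastforce

text \<open>Every term of a product is a product of terms of the factors, whatever cancels, so a
  condition on monomials that survives multiplication by monomials over \<open>V\<close> cuts out an
  ideal.\<close>

lemma monomial_ideal:
  assumes "\<And>m n. P m \<Longrightarrow> Poly_Mapping.keys n \<subseteq> V \<Longrightarrow> P (m + n)"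
  shows "ideal {p \<in> carrier (poly_ring V). \<forall>m\<in>Poly_Mapping.keys p. P m} (poly_ring V :: ('v, 'k::field) mpoly ring)"
    (is "ideal ?I _")
proof (rule idealI[OF ring_poly_ring])
  show "subgroup ?I (add_monoid (poly_ring V))"
  proof (rule group.subgroupI)
    show "group (add_monoid (poly_ring V :: ('v, 'k) mpoly ring))"
      using abelian_group.a_group ring.is_abelian_group ring_poly_ring by blast
    show "?I \<noteq> {}"
      by (auto intro: exI[of _ 0])
  next
    fix p :: "('v, 'k) mpoly" assume "p \<in> ?I"
    then show "inv\<^bsub>add_monoid (poly_ring V)\<^esub> p \<in> ?I"
      using poly_ring_a_inv[of p V] unfolding a_inv_def by simp
  next
    fix p q :: "('v, 'k) mpoly" assume "p \<in> ?I" "q \<in> ?I"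
    then show "p \<otimes>\<^bsub>add_monoid (poly_ring V)\<^esub> q \<in> ?I"
      using keys_add[of p q] poly_carrier_add[of p V q] by auto
  qed auto
  have *: "q * p \<in> ?I" if "p \<in> ?I" "q \<in> carrier (poly_ring V)" for p q :: "('v, 'k) mpoly"
  proof -
    have "P m" if m: "m \<in> Poly_Mapping.keys (q * p)" for m
    proof -
      obtain n r where "n \<in> Poly_Mapping.keys q" "r \<in> Poly_Mapping.keys p" "m = n + r"
        using m keys_mult[of q p] by blast
      then have "n \<in> Poly_Mapping.keys q" "r \<in> Poly_Mapping.keys p" "m = r + n"
        by (simp_all add: add.commute)
      then show ?thesis
        using \<open>p \<in> ?I\<close> \<open>q \<in> carrier _\<close> assms[of r n] by auto
    qed
    then show ?thesis
      using that poly_carrier_mult[of q V p] by blast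
  qed
  fix p q :: "('v, 'k) mpoly" assume "p \<in> ?I" "q \<in> carrier (poly_ring V)"
  then show "q \<otimes>\<^bsub>poly_ring V\<^esub> p \<in> ?I" "p \<otimes>\<^bsub>poly_ring V\<^esub> q \<in> ?I"
    using *[of p q] by (simp_all only: poly_ring_simps mult.commute)
qed

lemma irrelevant_ideal_ideal: "ideal (irrelevant_ideal V) (poly_ring V :: ('v, 'k::field) mpoly ring)"
  unfolding irrelevant_ideal_def
  by (rule ring.genideal_ideal[OF ring_poly_ring]) (auto simp: var_def)

text \<open>A nonconstant monomial has a variable as a factor.\<close>

lemma single_irrelevant:
  assumes "Poly_Mapping.keys m \<subseteq> V" "m \<noteq> 0"
  shows "Poly_Mapping.single m c \<in> (irrelevant_ideal V :: ('v, 'k::field) mpoly set)"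
proof -
  obtain x where x: "x \<in> Poly_Mapping.keys m"
    using assms(2) by fastforce
  then have "mon_dvd (Poly_Mapping.single x 1) m"
    by (auto simp: mon_dvd_iff lookup_single when_def in_keys_iff)
  then obtain r where r: "m = Poly_Mapping.single x 1 + r"
    by (auto simp: mon_dvd_def)
  have "var x \<in> (irrelevant_ideal V :: ('v, 'k) mpoly set)"
    unfolding irrelevant_ideal_def
    by (rule subsetD[OF ring.genideal_self[OF ring_poly_ring]]) (use x assms(1) in \<open>auto simp: var_def\<close>)
  moreover have "Poly_Mapping.single r c \<in> carrier (poly_ring V)"
    using assms(1) r by (simp add: keys_plus_mon)
  ultimately have "Poly_Mapping.single r c * var x \<in> irrelevant_ideal V"
    using ideal_poly_mult irrelevant_ideal_ideal by blast
  then show ?thesis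
    by (simp add: var_def mult_single r add.commute)
qed

section \<open>The cover ideal, its generators and its Scarf complex\<close>

context simple_graph
begin

lemma finite_cover: "min_cover V E W \<Longrightarrow> finite W"
  using min_cover_subset finite_V finite_subset by blast

lemma vertex_cover_mono: "vertex_cover V E W \<Longrightarrow> W \<subseteq> W' \<Longrightarrow> W' \<subseteq> V \<Longrightarrow> vertex_cover V E W'"
  unfolding vertex_cover_def by (meson disjoint_iff subsetD)

lemma vertex_cover_plus:
  fixes m n :: "'v mon"
  assumes "vertex_cover V E (Poly_Mapping.keys m)" "Poly_Mapping.keys n \<subseteq> V"
  shows "vertex_cover V E (Poly_Mapping.keys (m + n))"
  using assms(1)
proof (rule vertex_cover_mono)
  have "Poly_Mapping.keys m \<subseteq> V"
    using assms(1) by (simp add: vertex_cover_def)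
  then show "Poly_Mapping.keys (m + n) \<subseteq> V"
    using assms(2) by (simp add: keys_plus_mon)
qed (simp add: keys_plus_mon)

text \<open>Membership can be tested term by term. The right-hand side is an ideal since enlarging a
  cover inside \<open>V\<close> leaves it a cover; conversely, each of its terms is a multiple of
  the generator belonging to the support of that term.\<close>

lemma cover_ideal_eq:
  "(cover_ideal V E :: ('v, 'k::field) mpoly set) =
    {p \<in> carrier (poly_ring V). \<forall>m\<in>Poly_Mapping.keys p. vertex_cover V E (Poly_Mapping.keys m)}"
    (is "_ = ?I")
proof -
  let ?G = "{\<Prod>x\<in>W. var x | W. vertex_cover V E W} :: ('v, 'k) mpoly set"
  have fin: "finite W" if "vertex_cover V E W" for W
    using that finite_V finite_subset by (auto simp: vertex_cover_def)
  have G: "?G = (\<lambda>W. Poly_Mapping.single (sqfree W) 1) ` Collect (vertex_cover V E)"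
    using fin by (force simp: prod_var)
  have G_sub: "?G \<subseteq> ?I"
    unfolding G using fin by (auto simp: vertex_cover_def)
  have I: "ideal ?I (poly_ring V)"
    by (intro monomial_ideal vertex_cover_plus)
  have J: "ideal (Idl\<^bsub>poly_ring V\<^esub> ?G) (poly_ring V)"
    using G_sub by (intro ring.genideal_ideal[OF ring_poly_ring]) blast
  have "p \<in> Idl\<^bsub>poly_ring V\<^esub> ?G" if p: "p \<in> ?I" for p :: "('v, 'k) mpoly"
  proof -
    have "Poly_Mapping.single m c \<in> Idl\<^bsub>poly_ring V\<^esub> ?G" if m: "m \<in> Poly_Mapping.keys p" for m c
    proof -
      let ?W = "Poly_Mapping.keys m"
      obtain r where r: "m = sqfree ?W + r"
        using sqfree_keys_dvd[of m] by (auto simp: mon_dvd_def)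
      have W: "vertex_cover V E ?W" "?W \<subseteq> V"
        using p m by auto
      have "Poly_Mapping.single r c \<in> carrier (poly_ring V)"
        using W(2) by (subst (asm) r) (simp add: keys_plus_mon)
      moreover have "Poly_Mapping.single (sqfree ?W) 1 \<in> Idl\<^bsub>poly_ring V\<^esub> ?G"
        by (rule subsetD[OF ring.genideal_self[OF ring_poly_ring]]) (use G_sub G W in blast)+
      ultimately have "Poly_Mapping.single r c * Poly_Mapping.single (sqfree ?W) 1 \<in> Idl\<^bsub>poly_ring V\<^esub> ?G"
        using ideal_poly_mult J by blast
      then show ?thesis
        by (subst r) (simp add: mult_single add.commute)
    qed
    then have "(\<Sum>m\<in>Poly_Mapping.keys p. Poly_Mapping.single m (Poly_Mapping.lookup p m)) \<in> Idl\<^bsub>poly_ring V\<^esub> ?G"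
      by (intro ideal_poly_sum[OF J])
    then show ?thesis
      by (simp add: poly_mapping_sum_single)
  qed
  moreover have "Idl\<^bsub>poly_ring V\<^esub> ?G \<subseteq> ?I"
    using ring.genideal_minimal[OF ring_poly_ring I G_sub] .
  ultimately show ?thesis
    unfolding cover_ideal_def by blast
qed

lemma cover_ideal_ideal: "ideal (cover_ideal V E) (poly_ring V :: ('v, 'k::field) mpoly ring)"
  unfolding cover_ideal_eq
  by (intro monomial_ideal vertex_cover_plus)

lemma single_in_cover_ideal:
  "Poly_Mapping.single m 1 \<in> (cover_ideal V E :: ('v, 'k::field) mpoly set) \<longleftrightarrow>
    vertex_cover V E (Poly_Mapping.keys m)"
  by (auto simp: cover_ideal_eq vertex_cover_def)

text \<open>Whether a monomial is in the ideal depends on its support alone, so the squarefree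
  monomial on that support is in the ideal too and divides it. Hence minimal generators are
  squarefree, and divisibility among these is inclusion of supports.\<close>

lemma mingens_cover_ideal:
  "mingens (cover_ideal V E :: ('v, 'k::field) mpoly set) = sqfree ` Collect (min_cover V E)"
proof (intro equalityI subsetI)
  fix m assume "m \<in> mingens (cover_ideal V E :: ('v, 'k) mpoly set)"
  then have m: "vertex_cover V E (Poly_Mapping.keys m)"
    and min: "\<And>n. vertex_cover V E (Poly_Mapping.keys n) \<Longrightarrow> mon_dvd n m \<Longrightarrow> n = m"
    unfolding mingens_def single_in_cover_ideal by blast+
  have eq: "sqfree (Poly_Mapping.keys m) = m"
    by (intro min sqfree_keys_dvd) (use m in simp)
  have "min_cover V E (Poly_Mapping.keys m)"
    unfolding min_cover_def
  proof (intro conjI allI impI m)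
    fix W assume W: "vertex_cover V E W \<and> W \<subseteq> Poly_Mapping.keys m"
    then have fin: "finite W"
      using finite_subset by fastforce
    then have "mon_dvd (sqfree W) (sqfree (Poly_Mapping.keys m))"
      using W by (auto simp: mon_dvd_iff)
    then have "sqfree W = m"
      using W fin by (intro min) (simp_all add: eq)
    then show "W = Poly_Mapping.keys m"
      using fin keys_sqfree by metis
  qed
  then show "m \<in> sqfree ` Collect (min_cover V E)"
    using eq by (metis image_eqI mem_Collect_eq)
next
  fix m assume "m \<in> sqfree ` Collect (min_cover V E)"
  then obtain W where W: "min_cover V E W" "m = sqfree W" by blast
  then have m: "Poly_Mapping.keys m = W"
    using finite_cover by simp
  show "m \<in> mingens (cover_ideal V E :: ('v, 'k) mpoly set)"
    unfolding mingens_def single_in_cover_ideal mem_Collect_eq m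
  proof (intro conjI allI impI min_cover_imp_vertex_cover W(1))
    fix n :: "'v mon" assume n: "vertex_cover V E (Poly_Mapping.keys n) \<and> mon_dvd n m"
    then have le: "Poly_Mapping.lookup n x \<le> of_bool (x \<in> W)" for x
      using finite_cover[OF W(1)] W(2) by (auto simp: mon_dvd_iff dest!: spec[of _ x])
    have sub: "Poly_Mapping.keys n \<subseteq> W"
    proof
      fix x assume "x \<in> Poly_Mapping.keys n"
      then show "x \<in> W"
        using le[of x] by (cases "x \<in> W") (auto simp: in_keys_iff)
    qed
    then have keys: "Poly_Mapping.keys n = W"
      using W(1) n by (auto simp: min_cover_def)
    show "n = m"
    proof (rule poly_mapping_eqI)
      fix x
      show "Poly_Mapping.lookup n x = Poly_Mapping.lookup m x"
        using le[of x] keys in_keys_iff[of x n] finite_cover[OF W(1)] W(2) by (cases "x \<in> W") auto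
    qed
  qed
qed

lemma sqfree_image_inj: "\<W> \<subseteq> Collect (min_cover V E) \<Longrightarrow> \<T> \<subseteq> Collect (min_cover V E) \<Longrightarrow>
    sqfree ` \<W> = sqfree ` \<T> \<longleftrightarrow> \<W> = \<T>"
  using finite_cover by (intro inj_on_image_eq_iff[of _ "Collect (min_cover V E)"]) (auto intro: inj_onI)

lemma mon_lcm_cover: "\<W> \<subseteq> Collect (min_cover V E) \<Longrightarrow> mon_lcm (sqfree ` \<W>) = sqfree (\<Union>\<W>)"
  using finite_cover finite_min_covers finite_subset by (intro mon_lcm_sqfree) blast+

lemma finite_Union_covers: "\<W> \<subseteq> Collect (min_cover V E) \<Longrightarrow> finite (\<Union>\<W>)"
  using finite_cover finite_subset[OF _ finite_min_covers] by (intro finite_Union) blast+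

lemma scarf_complex_cover_ideal:
  "scarf_complex (mingens (cover_ideal V E :: ('v, 'k::field) mpoly set)) = image sqfree ` scarf_family V E"
proof -
  let ?M = "Collect (min_cover V E)"
  have iff: "sqfree ` \<W> \<in> scarf_complex (sqfree ` ?M) \<longleftrightarrow> \<W> \<in> scarf_family V E"
    if \<W>: "\<W> \<subseteq> Collect (min_cover V E)" for \<W>
  proof -
    have "(\<forall>\<tau>. \<tau> \<subseteq> sqfree ` Collect (min_cover V E) \<and> \<tau> \<noteq> sqfree ` \<W> \<longrightarrow> mon_lcm (sqfree ` \<W>) \<noteq> mon_lcm \<tau>)
      \<longleftrightarrow> (\<forall>\<T>. \<T> \<subseteq> Collect (min_cover V E) \<and> \<T> \<noteq> \<W> \<longrightarrow> \<Union>\<W> \<noteq> \<Union>\<T>)" (is "?L \<longleftrightarrow> ?R")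
    proof
      assume L: ?L
      show ?R
      proof (intro allI impI)
        fix \<T> assume \<T>: "\<T> \<subseteq> Collect (min_cover V E) \<and> \<T> \<noteq> \<W>"
        then have "mon_lcm (sqfree ` \<W>) \<noteq> mon_lcm (sqfree ` \<T>)"
          using L \<W> by (simp add: image_mono sqfree_image_inj)
        then show "\<Union>\<W> \<noteq> \<Union>\<T>"
          using \<W> \<T> by (auto simp: mon_lcm_cover)
      qed
    next
      assume R: ?R
      show ?L
      proof (intro allI impI)
        fix \<tau> assume \<tau>: "\<tau> \<subseteq> sqfree ` Collect (min_cover V E) \<and> \<tau> \<noteq> sqfree ` \<W>"
        then obtain \<T> where \<T>: "\<T> \<subseteq> Collect (min_cover V E)" "\<tau> = sqfree ` \<T>"
          by (meson subset_image_iff)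
        then have "\<Union>\<W> \<noteq> \<Union>\<T>"
          using R \<tau> by blast
        then show "mon_lcm (sqfree ` \<W>) \<noteq> mon_lcm \<tau>"
          using \<W> \<T> finite_Union_covers by (simp add: mon_lcm_cover)
      qed
    qed
    also have "\<dots> \<longleftrightarrow> (\<forall>\<T>. \<T> \<subseteq> Collect (min_cover V E) \<and> \<Union>\<T> = \<Union>\<W> \<longrightarrow> \<T> = \<W>)"
      by metis
    finally show ?thesis
      unfolding scarf_complex_def scarf_family_def mem_Collect_eq
      by (simp only: image_mono[OF \<W>] \<W> simp_thms)
  qed
  show ?thesis
    unfolding mingens_cover_ideal
  proof (intro equalityI subsetI)
    fix \<sigma> assume \<sigma>: "\<sigma> \<in> scarf_complex (sqfree ` ?M)"
    then have "\<sigma> \<subseteq> sqfree ` ?M"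
      by (simp add: scarf_complex_def)
    then obtain \<T> where "\<T> \<subseteq> ?M" "\<sigma> = sqfree ` \<T>"
      by (rule subset_imageE)
    then show "\<sigma> \<in> image sqfree ` scarf_family V E"
      using \<sigma> iff by simp
  next
    fix \<sigma> assume "\<sigma> \<in> image sqfree ` scarf_family V E"
    then obtain \<T> where "\<T> \<in> scarf_family V E" "\<sigma> = sqfree ` \<T>"
      by (rule imageE)
    moreover from this have "\<T> \<subseteq> ?M"
      by (simp add: scarf_family_def)
    ultimately show "\<sigma> \<in> scarf_complex (sqfree ` ?M)"
      using iff by simp
  qed
qed

text \<open>Let \<open>\<R>\<close> have the same union as \<open>\<T>\<close>. Adding
  \<open>\<W> - \<T>\<close> to \<open>\<R>\<close> gives a family with the union of
  \<open>\<W>\<close>, hence \<open>\<W>\<close> itself, so \<open>\<R>\<close> contains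
  \<open>\<T>\<close>. A member of \<open>\<R>\<close> outside \<open>\<T>\<close> would be covered
  by \<open>\<T>\<close> and could be deleted from \<open>\<W>\<close> without changing the
  union.\<close>

lemma scarf_family_subset:
  assumes "\<W> \<in> scarf_family V E" "\<T> \<subseteq> \<W>"
  shows "\<T> \<in> scarf_family V E"
proof -
  have \<W>: "\<W> \<subseteq> Collect (min_cover V E)"
    using assms(1) by (simp add: scarf_family_def)
  have "\<R> = \<T>" if \<R>: "\<R> \<subseteq> Collect (min_cover V E)" "\<Union>\<R> = \<Union>\<T>" for \<R>
  proof -
    have eq: "\<R> \<union> (\<W> - \<T>) = \<W>"
      by (rule scarf_family_unique[OF assms(1)]) (use \<R> \<W> assms(2) in auto)
    have "W \<in> \<T>" if "W \<in> \<R>" for W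
    proof (rule ccontr)
      assume W: "W \<notin> \<T>"
      have "\<Union>(\<W> - {W}) = \<Union>\<W>"
      proof (intro equalityI subsetI)
        fix x assume x: "x \<in> \<Union>\<W>"
        show "x \<in> \<Union>(\<W> - {W})"
        proof (cases "x \<in> W")
          case True
          then have "x \<in> \<Union>\<T>"
            using that \<R>(2) by auto
          then show ?thesis
            using W assms(2) by blast
        qed (use x in blast)
      qed blast
      then have "\<W> - {W} = \<W>"
        by (intro scarf_family_unique[OF assms(1)]) (use \<W> in blast)
      moreover have "W \<in> \<W>"
        using eq that by blast
      ultimately show False
        by (metis Diff_iff singletonI)
    qed
    then show ?thesis
      using eq assms(2) by blast
  qed
  then show ?thesis
    using \<W> assms(2) by (auto simp: scarf_family_def)
qed

text \<open>Every member of a Scarf face thus owns a vertex that no other member has. This makes the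
  quotients of lcms in the differential nonconstant, which is minimality of the resolution.\<close>

lemma scarf_family_remove:
  assumes "\<W> \<in> scarf_family V E" "W \<in> \<W>"
  shows "\<not> \<Union>\<W> \<subseteq> \<Union>(\<W> - {W})"
proof
  assume "\<Union>\<W> \<subseteq> \<Union>(\<W> - {W})"
  then have "\<W> - {W} = \<W>"
    by (intro scarf_family_unique[OF assms(1)]) (use assms(1) in \<open>auto simp: scarf_family_def\<close>)
  then show False
    using assms(2) by (metis Diff_iff singletonI)
qed

end


section \<open>The Taylor differential in low degrees\<close>

lemma taylor_basis_diff_nonzeroD:
  assumes "taylor_basis_diff ms \<sigma> \<tau> \<noteq> (0 :: ('v, 'k::field) mpoly)"
  shows "\<exists>m\<in>\<sigma>. \<tau> = \<sigma> - {m}"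
proof (rule ccontr)
  assume "\<not> ?thesis"
  moreover have "filter (\<lambda>m. m \<in> \<sigma>) ms ! j \<in> \<sigma>" if "j < length (filter (\<lambda>m. m \<in> \<sigma>) ms)" for j
    using nth_mem[OF that] by simp
  ultimately have "taylor_basis_diff ms \<sigma> \<tau> = (0 :: ('v, 'k) mpoly)"
    unfolding taylor_basis_diff_def Let_def by (intro sum.neutral) auto
  with assms show False ..
qed

lemma taylor_basis_diff_singleton:
  assumes "distinct ms" "m \<in> set ms"
  shows "taylor_basis_diff ms {m} {} = Poly_Mapping.single (mon_lcm {m} - mon_lcm {}) 1"
proof -
  let ?l = "filter (\<lambda>x. x \<in> {m}) ms"
  have l: "set ?l = {m}" "distinct ?l"
    using assms by auto
  then have "length ?l = 1"
    using distinct_card[of ?l] by simp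
  then obtain x where "?l = [x]"
    by (auto simp: length_Suc_conv)
  then have "?l = [m]"
    using l(1) by simp
  then show ?thesis
    unfolding taylor_basis_diff_def Let_def by simp
qed

lemma filter_pair:
  assumes "distinct ms" "m \<in> set ms" "n \<in> set ms" "m \<noteq> n"
  shows "filter (\<lambda>x. x \<in> {m, n}) ms = [m, n] \<or> filter (\<lambda>x. x \<in> {m, n}) ms = [n, m]"
proof -
  let ?l = "filter (\<lambda>x. x \<in> {m, n}) ms"
  have l: "set ?l = {m, n}" "distinct ?l"
    using assms by auto
  then have "length ?l = 2"
    using distinct_card[of ?l] assms(4) by simp
  then obtain x y where "?l = [x, y]"
    by (auto simp: length_Suc_conv numeral_2_eq_2)
  then show ?thesis
    using l assms(4) by (auto simp: doubleton_eq_iff)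
qed

text \<open>Intended for a pair \<open>\<sigma>\<close> containing \<open>m\<close>: the sign of the
  face \<open>{m}\<close>, which arises by removing the other element. If \<open>m\<close> is listed
  first, the removed element stands at position 1, whence -1; the sign is therefore not that of the
  position of \<open>m\<close>.\<close>

definition taylor_sign :: "'v mon list \<Rightarrow> 'v mon set \<Rightarrow> 'v mon \<Rightarrow> 'k::field" where
  "taylor_sign ms \<sigma> m = (if m = hd (filter (\<lambda>x. x \<in> \<sigma>) ms) then -1 else 1)"

lemma taylor_sign_pair:
  assumes "distinct ms" "m \<in> set ms" "n \<in> set ms" "m \<noteq> n"
  shows "taylor_sign ms {m, n} m = (- taylor_sign ms {m, n} n :: 'k::field)"
  using filter_pair[OF assms] assms(4) unfolding taylor_sign_def by auto

lemma taylor_sign_square: "taylor_sign ms \<sigma> m * taylor_sign ms \<sigma> m = (1 :: 'k::field)"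
  by (simp add: taylor_sign_def)

lemma taylor_basis_diff_filter_pair:
  assumes "filter (\<lambda>x. x \<in> \<sigma>) ms = [m, n]"
  shows "taylor_basis_diff ms \<sigma> \<tau> =
    (if \<tau> = \<sigma> - {m} then Poly_Mapping.single (mon_lcm \<sigma> - mon_lcm (\<sigma> - {m})) (1 :: 'k::field) else 0) +
    (if \<tau> = \<sigma> - {n} then - Poly_Mapping.single (mon_lcm \<sigma> - mon_lcm (\<sigma> - {n})) 1 else 0)"
  unfolding taylor_basis_diff_def Let_def assms by (simp add: lessThan_Suc)

lemma taylor_basis_diff_pair:
  assumes "distinct ms" "m \<in> set ms" "n \<in> set ms" "m \<noteq> n"
  shows "taylor_basis_diff ms {m, n} {m}
    = Poly_Mapping.single (mon_lcm {m, n} - mon_lcm {m}) (taylor_sign ms {m, n} m :: 'k::field)"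
proof -
  have D: "{m, n} - {m} = {n}" "{m, n} - {n} = {m}" "{m} \<noteq> {n}"
    using assms(4) by auto
  from filter_pair[OF assms] show ?thesis
  proof
    assume l: "filter (\<lambda>x. x \<in> {m, n}) ms = [m, n]"
    show ?thesis
      unfolding taylor_basis_diff_filter_pair[OF l] taylor_sign_def l D
      using D(3) by (simp add: single_uminus)
  next
    assume l: "filter (\<lambda>x. x \<in> {m, n}) ms = [n, m]"
    show ?thesis
      unfolding taylor_basis_diff_filter_pair[OF l] taylor_sign_def l D
      using D(3) assms(4) by simp
  qed
qed

lemma free_module_carrier_iff:
  assumes "finite B"
  shows "c \<in> carrier (free_module (poly_ring V) B) \<longleftrightarrow>
    (\<forall>b. c b \<in> carrier (poly_ring V)) \<and> (\<forall>b. b \<notin> B \<longrightarrow> c b = 0)"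
proof
  assume "c \<in> carrier (free_module (poly_ring V) B)"
  then have c: "\<And>b. b \<in> B \<Longrightarrow> c b \<in> carrier (poly_ring V)" "\<forall>b. b \<notin> B \<longrightarrow> c b = 0"
    by (simp_all add: free_module_def)
  have "c b \<in> carrier (poly_ring V)" for b
    using c by (cases "b \<in> B") simp_all
  with c(2) show "(\<forall>b. c b \<in> carrier (poly_ring V)) \<and> (\<forall>b. b \<notin> B \<longrightarrow> c b = 0)"
    by blast
next
  assume c: "(\<forall>b. c b \<in> carrier (poly_ring V)) \<and> (\<forall>b. b \<notin> B \<longrightarrow> c b = 0)"
  have "finite {b. c b \<noteq> 0}"
    by (rule finite_subset[OF _ assms]) (use c in auto)
  with c show "c \<in> carrier (free_module (poly_ring V) B)"
    by (simp add: free_module_def)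
qed

text \<open>The basis in homological degree \<open>i\<close>, expressed through families of covers,
  so that neither the coefficient field nor the ideal appears in it.\<close>

definition scarf_basis :: "'v set \<Rightarrow> 'v set set \<Rightarrow> nat \<Rightarrow> 'v mon set set" where
  "scarf_basis V E i = image sqfree ` {\<W> \<in> scarf_family V E. card \<W> = i}"

context simple_graph
begin

lemma scarf_family_covers: "\<W> \<in> scarf_family V E \<Longrightarrow> \<W> \<subseteq> Collect (min_cover V E)"
  by (simp add: scarf_family_def)

lemma finite_scarf: "\<W> \<in> scarf_family V E \<Longrightarrow> finite \<W>"
  using scarf_family_covers finite_min_covers finite_subset by blast

lemma sqfree_inj_on: "inj_on sqfree (Collect (min_cover V E))"
  using finite_cover by (auto intro: inj_onI)

lemma card_sqfree_image: "\<W> \<subseteq> Collect (min_cover V E) \<Longrightarrow> card (sqfree ` \<W>) = card \<W>"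
  using sqfree_inj_on by (meson card_image inj_on_subset)

lemma scarf_basis_eq:
  "{\<sigma> \<in> scarf_complex (mingens (cover_ideal V E :: ('v, 'k::field) mpoly set)). card \<sigma> = i} = scarf_basis V E i"
  unfolding scarf_complex_cover_ideal scarf_basis_def
  using card_sqfree_image[OF scarf_family_covers] by auto

lemma finite_scarf_basis: "finite (scarf_basis V E i)"
  unfolding scarf_basis_def using finite_scarf_family by simp

lemma scarf_basis_carrier:
  "c \<in> carrier (free_module (poly_ring V) (scarf_basis V E i)) \<longleftrightarrow>
    (\<forall>b. c b \<in> carrier (poly_ring V :: ('v, 'k::field) mpoly ring)) \<and> (\<forall>b. b \<notin> scarf_basis V E i \<longrightarrow> c b = 0)"
  by (rule free_module_carrier_iff[OF finite_scarf_basis])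

text \<open>A family whose union is a minimal cover \<open>W\<close> consists of covers inside
  \<open>W\<close>, hence of \<open>W\<close> alone. It is nonempty because \<open>W\<close> has to
  meet an edge.\<close>

lemma singleton_scarf:
  assumes "E \<noteq> {}" "min_cover V E W"
  shows "{W} \<in> scarf_family V E"
proof -
  have "\<R> = {W}" if \<R>: "\<R> \<subseteq> Collect (min_cover V E)" "\<Union>\<R> = W" for \<R>
  proof -
    have "W \<noteq> {}"
      using assms by (auto simp: min_cover_def vertex_cover_def)
    then have "\<R> \<noteq> {}"
      using \<R>(2) by auto
    moreover have "T = W" if T: "T \<in> \<R>" for T
    proof -
      have "T \<subseteq> W"
        using T \<R>(2) by auto
      moreover have "vertex_cover V E T"
        using T \<R>(1) min_cover_imp_vertex_cover by auto
      ultimately show ?thesis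
        using assms(2) by (simp add: min_cover_def)
    qed
    then have "\<R> \<subseteq> {W}"
      by auto
    ultimately show ?thesis
      by (simp add: subset_singleton_iff)
  qed
  then show ?thesis
    using assms(2) by (simp add: scarf_family_def)
qed

section \<open>The Scarf subcomplex of the Taylor complex\<close>

context
  fixes ms :: "'v mon list"
  assumes ms: "distinct ms" "set ms = sqfree ` Collect (min_cover V E)"
begin

text \<open>The monomial in each entry is the product of the vertices owned by the removed cover
  alone, of which there is at least one by \<open>scarf_family_remove\<close>. Besides minimality,
  this shows that the differential stays inside \<open>poly_ring V\<close>.\<close>

lemma taylor_basis_diff_irrelevant:
  assumes "\<W> \<in> scarf_family V E"
  shows "taylor_basis_diff ms (sqfree ` \<W>) \<tau> \<in> (irrelevant_ideal V :: ('v, 'k::field) mpoly set)"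
  unfolding taylor_basis_diff_def Let_def
proof (intro ideal_poly_sum[OF irrelevant_ideal_ideal])
  let ?\<sigma> = "sqfree ` \<W>" and ?l = "filter (\<lambda>m. m \<in> sqfree ` \<W>) ms"
  fix j assume "j \<in> {..<length ?l}"
  then have "?l ! j \<in> ?\<sigma>"
    using nth_mem[of j ?l] by simp
  then obtain W where W: "W \<in> \<W>" "?l ! j = sqfree W"
    by auto
  have covers: "\<W> \<subseteq> Collect (min_cover V E)"
    using assms by (rule scarf_family_covers)
  have "?\<sigma> - {sqfree W} = sqfree ` (\<W> - {W})"
    using inj_on_image_set_diff[OF sqfree_inj_on, of \<W> "{W}"] covers W(1) by auto
  moreover have covers': "\<W> - {W} \<subseteq> Collect (min_cover V E)"
    using covers by blast
  ultimately have eq: "mon_lcm ?\<sigma> - mon_lcm (?\<sigma> - {?l ! j}) = sqfree (\<Union>\<W> - \<Union>(\<W> - {W}))"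
    by (simp only: W(2) mon_lcm_cover[OF covers] mon_lcm_cover[OF covers']
        sqfree_minus[OF finite_Union_covers[OF covers] finite_Union_covers[OF covers']])
  have fin: "finite (\<Union>\<W> - \<Union>(\<W> - {W}))"
    using finite_Union_covers[OF covers] by blast
  have "\<Union>\<W> \<subseteq> V"
    using covers min_cover_subset by blast
  moreover have "sqfree (\<Union>\<W> - \<Union>(\<W> - {W})) \<noteq> sqfree {}"
    using scarf_family_remove[OF assms W(1)] fin sqfree_inj[OF fin finite.emptyI] by blast
  ultimately have "Poly_Mapping.single (mon_lcm ?\<sigma> - mon_lcm (?\<sigma> - {?l ! j})) 1 \<in> (irrelevant_ideal V :: ('v, 'k) mpoly set)"
    unfolding eq using fin by (intro single_irrelevant) auto
  moreover have "(-1) ^ j \<in> carrier (poly_ring V :: ('v, 'k) mpoly ring)"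
    by (cases "even j") simp_all
  ultimately show "(if \<tau> = ?\<sigma> - {?l ! j} then (-1) ^ j * Poly_Mapping.single (mon_lcm ?\<sigma> - mon_lcm (?\<sigma> - {?l ! j})) 1
      else 0) \<in> (irrelevant_ideal V :: ('v, 'k) mpoly set)"
    using ideal_poly_mult[OF irrelevant_ideal_ideal]
      additive_subgroup.zero_closed[OF ideal.axioms(1)[OF irrelevant_ideal_ideal[where ?'k = 'k and V = V]]]
    by auto
qed

lemma taylor_diff_eq:
  fixes c :: "'v mon set \<Rightarrow> ('v, 'k::field) mpoly"
  assumes "c \<in> carrier (free_module (poly_ring V) (scarf_basis V E i))"
  shows "taylor_diff ms c \<tau> =
    (\<Sum>\<W> | \<W> \<in> scarf_family V E \<and> card \<W> = i. c (sqfree ` \<W>) * taylor_basis_diff ms (sqfree ` \<W>) \<tau>)"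
proof -
  have "scarf_basis V E i \<subseteq> Pow (set ms)"
    unfolding scarf_basis_def ms using scarf_family_covers by blast
  then have "taylor_diff ms c \<tau> = (\<Sum>\<sigma>\<in>scarf_basis V E i. c \<sigma> * taylor_basis_diff ms \<sigma> \<tau>)"
    unfolding taylor_diff_def using assms unfolding scarf_basis_carrier
    by (intro sum.mono_neutral_right) auto
  also have "\<dots> = (\<Sum>\<W> | \<W> \<in> scarf_family V E \<and> card \<W> = i. c (sqfree ` \<W>) * taylor_basis_diff ms (sqfree ` \<W>) \<tau>)"
    unfolding scarf_basis_def
  proof (subst sum.reindex)
    show "inj_on (image sqfree) {\<W> \<in> scarf_family V E. card \<W> = i}"
      by (rule inj_onI) (simp add: sqfree_image_inj scarf_family_covers)
  qed simp
  finally show ?thesis .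
qed

lemma taylor_diff_irrelevant:
  fixes c :: "'v mon set \<Rightarrow> ('v, 'k::field) mpoly"
  assumes "c \<in> carrier (free_module (poly_ring V) (scarf_basis V E i))"
  shows "taylor_diff ms c \<tau> \<in> irrelevant_ideal V"
  unfolding taylor_diff_eq[OF assms]
  using assms unfolding scarf_basis_carrier
  by (intro ideal_poly_sum[OF irrelevant_ideal_ideal] ideal_poly_mult[OF irrelevant_ideal_ideal]
      taylor_basis_diff_irrelevant) auto

lemma taylor_diff_carrier:
  fixes c :: "'v mon set \<Rightarrow> ('v, 'k::field) mpoly"
  assumes "c \<in> carrier (free_module (poly_ring V) (scarf_basis V E (Suc i)))"
  shows "taylor_diff ms c \<in> carrier (free_module (poly_ring V) (scarf_basis V E i))"
  unfolding scarf_basis_carrier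
proof (intro conjI allI impI)
  fix \<tau>
  show "taylor_diff ms c \<tau> \<in> carrier (poly_ring V)"
    using ideal.Icarr[OF irrelevant_ideal_ideal taylor_diff_irrelevant[OF assms]] .
  show "taylor_diff ms c \<tau> = 0" if \<tau>: "\<tau> \<notin> scarf_basis V E i"
    unfolding taylor_diff_eq[OF assms]
  proof (intro sum.neutral ballI)
    fix \<W> assume "\<W> \<in> {\<W>. \<W> \<in> scarf_family V E \<and> card \<W> = Suc i}"
    then have \<W>: "\<W> \<in> scarf_family V E" "card \<W> = Suc i"
      by auto
    have "taylor_basis_diff ms (sqfree ` \<W>) \<tau> = (0 :: ('v, 'k) mpoly)"
    proof (rule ccontr)
      assume "taylor_basis_diff ms (sqfree ` \<W>) \<tau> \<noteq> (0 :: ('v, 'k) mpoly)"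
      then obtain W where W: "W \<in> \<W>" "\<tau> = sqfree ` \<W> - {sqfree W}"
        using taylor_basis_diff_nonzeroD by blast
      then have "\<tau> = sqfree ` (\<W> - {W})"
        using inj_on_image_set_diff[OF sqfree_inj_on, of \<W> "{W}"] scarf_family_covers[OF \<W>(1)] by auto
      moreover have "\<W> - {W} \<in> scarf_family V E" "card (\<W> - {W}) = i"
        using \<W> W(1) scarf_family_subset finite_scarf by auto
      ultimately show False
        using \<tau> unfolding scarf_basis_def by blast
    qed
    then show "c (sqfree ` \<W>) * taylor_basis_diff ms (sqfree ` \<W>) \<tau> = 0"
      by simp
  qed
qed

lemma taylor_diff_0:
  fixes c :: "'v mon set \<Rightarrow> ('v, 'k::field) mpoly"
  assumes c: "c \<in> carrier (free_module (poly_ring V) (scarf_basis V E 1))" and "E \<noteq> {}"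
  shows "taylor_diff ms c {} = (\<Sum>W | min_cover V E W. c {sqfree W} * Poly_Mapping.single (sqfree W) 1)"
proof -
  have eq: "{\<W>. \<W> \<in> scarf_family V E \<and> card \<W> = 1} = (\<lambda>W. {W}) ` Collect (min_cover V E)"
    using scarf_family_covers singleton_scarf[OF assms(2)] by (auto simp: card_1_singleton_iff)
  have "taylor_diff ms c {} = (\<Sum>W | min_cover V E W. c {sqfree W} * taylor_basis_diff ms {sqfree W} {})"
    unfolding taylor_diff_eq[OF c] eq by (subst sum.reindex) auto
  also have "\<dots> = (\<Sum>W | min_cover V E W. c {sqfree W} * Poly_Mapping.single (sqfree W) 1)"
  proof (rule sum.cong[OF refl])
    fix W assume W: "W \<in> Collect (min_cover V E)"
    then have "mon_lcm {sqfree W} - mon_lcm {} = sqfree W"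
      using mon_lcm_cover[of "{W}"] mon_lcm_cover[of "{}"] by simp
    then show "c {sqfree W} * taylor_basis_diff ms {sqfree W} {} = c {sqfree W} * Poly_Mapping.single (sqfree W) 1"
      using W ms(2) by (simp add: taylor_basis_diff_singleton[OF ms(1)])
  qed
  finally show ?thesis .
qed

lemma taylor_basis_diff_edge:
  assumes "\<W> \<in> scarf_edges V E" "min_cover V E W"
  shows "taylor_basis_diff ms (sqfree ` \<W>) {sqfree W} =
    (if W \<in> \<W> then Poly_Mapping.single (sqfree (\<Union>\<W> - W)) (taylor_sign ms (sqfree ` \<W>) (sqfree W) :: 'k::field) else 0)"
proof (cases "W \<in> \<W>")
  case True
  obtain W' where W': "\<W> = {W, W'}" "W' \<noteq> W" "min_cover V E W'"
    using assms(1) True by (rule scarf_edge_containingE)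
  then have "mon_lcm (sqfree ` \<W>) - mon_lcm {sqfree W} = sqfree (\<Union>\<W>) - sqfree W"
    using mon_lcm_cover[of \<W>] mon_lcm_cover[of "{W}"] assms(2) by simp
  also have "\<dots> = sqfree (\<Union>\<W> - W)"
    using W' assms(2) finite_cover by (intro sqfree_minus) auto
  finally show ?thesis
    using taylor_basis_diff_pair[OF ms(1), of "sqfree W" "sqfree W'"] W' assms(2) True ms(2) finite_cover
    by simp
next
  case False
  have "{sqfree W} \<noteq> sqfree ` \<W> - {m}" for m
  proof
    assume eq: "{sqfree W} = sqfree ` \<W> - {m}"
    then have "sqfree W \<in> sqfree ` \<W>"
      by blast
    then obtain W' where "W' \<in> \<W>" "sqfree W = sqfree W'"
      by (rule imageE)
    moreover from this have "min_cover V E W'"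
      using assms(1) scarf_family_covers by (auto simp: scarf_edges_def)
    ultimately show False
      using False assms(2) finite_cover by simp
  qed
  then show ?thesis
    using False taylor_basis_diff_nonzeroD by metis
qed

text \<open>This is the sum in \<open>scarf_boundary\<close>, weighted at each pair by the vertices
  that the pair adds to \<open>W\<close>. Within one squarefree multidegree these weights are
  accounted for by the degree of the coefficient of the pair.\<close>

lemma taylor_diff_1:
  fixes c :: "'v mon set \<Rightarrow> ('v, 'k::field) mpoly"
  assumes c: "c \<in> carrier (free_module (poly_ring V) (scarf_basis V E 2))" and W: "min_cover V E W"
  shows "taylor_diff ms c {sqfree W} = (\<Sum>\<W> | \<W> \<in> scarf_edges V E \<and> W \<in> \<W>. c (sqfree ` \<W>) *
    Poly_Mapping.single (sqfree (\<Union>\<W> - W)) (taylor_sign ms (sqfree ` \<W>) (sqfree W)))"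
proof -
  have "taylor_diff ms c {sqfree W} = (\<Sum>\<W>\<in>scarf_edges V E. c (sqfree ` \<W>) * taylor_basis_diff ms (sqfree ` \<W>) {sqfree W})"
    unfolding taylor_diff_eq[OF c] scarf_edges_def by simp
  also have "\<dots> = (\<Sum>\<W>\<in>scarf_edges V E. if W \<in> \<W> then c (sqfree ` \<W>) *
      Poly_Mapping.single (sqfree (\<Union>\<W> - W)) (taylor_sign ms (sqfree ` \<W>) (sqfree W)) else 0)"
    by (intro sum.cong refl) (simp add: taylor_basis_diff_edge[OF _ W])
  also have "\<dots> = (\<Sum>\<W> | \<W> \<in> scarf_edges V E \<and> W \<in> \<W>. c (sqfree ` \<W>) *
    Poly_Mapping.single (sqfree (\<Union>\<W> - W)) (taylor_sign ms (sqfree ` \<W>) (sqfree W)))"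
    using finite_scarf_edges by (subst sum.inter_filter[symmetric]) simp_all
  finally show ?thesis .
qed

end

end


section \<open>Scarf cover ideals yield split graphs\<close>

context simple_graph
begin

context
  fixes ms :: "'v mon list"
  assumes ms: "distinct ms" "set ms = sqfree ` Collect (min_cover V E)"
    and E_ne: "E \<noteq> {}"
begin

abbreviation edge_sign :: "'v set set \<Rightarrow> 'v set \<Rightarrow> 'k::field" where
  "edge_sign \<W> W \<equiv> taylor_sign ms (sqfree ` \<W>) (sqfree W)"

lemma edge_sign_swap:
  "min_cover V E W1 \<Longrightarrow> min_cover V E W2 \<Longrightarrow> W1 \<noteq> W2 \<Longrightarrow>
    edge_sign {W1, W2} W1 = (- edge_sign {W1, W2} W2 :: 'k::field)"
  using taylor_sign_pair[OF ms(1), of "sqfree W1" "sqfree W2"] ms(2) finite_cover by simp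

lemma scarf_edge_subset:
  "\<W> \<in> scarf_edges V E \<Longrightarrow> \<W> \<subseteq> Collect (min_cover V E)"
  by (simp add: scarf_edges_def scarf_family_def)

lemma scarf_edge_Union_subset: "\<W> \<in> scarf_edges V E \<Longrightarrow> \<Union>\<W> \<subseteq> V"
  using scarf_edge_subset min_cover_subset by blast

lemma sqfree_scarf_edge_iff:
  "\<W> \<subseteq> Collect (min_cover V E) \<Longrightarrow> sqfree ` \<W> \<in> scarf_basis V E 2 \<longleftrightarrow> \<W> \<in> scarf_edges V E"
  unfolding scarf_basis_def scarf_edges_def
  by (auto simp: image_iff sqfree_image_inj scarf_family_covers)

text \<open>Lifted to the multidegree of \<open>V - U\<close>, the two basis elements have the same
  image, so their difference is a cycle and hence a boundary. The chain \<open>f\<close> consists of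
  the coefficients of a preimage in that multidegree.\<close>

lemma scarf_chain_connected:
  fixes U :: "'v set"
  assumes exact: "taylor_diff ms ` carrier (free_module (poly_ring V) (scarf_basis V E 2)) =
      {c \<in> carrier (free_module (poly_ring V :: ('v, 'k::field) mpoly ring) (scarf_basis V E 1)). taylor_diff ms c = (\<lambda>_. 0)}"
    and W1: "min_cover V E W1" "W1 \<inter> U = {}" and W2: "min_cover V E W2" "W2 \<inter> U = {}"
  shows "\<exists>f :: 'v set set \<Rightarrow> 'k. (\<forall>\<W>. f \<W> \<noteq> 0 \<longrightarrow> \<Union>\<W> \<inter> U = {}) \<and>
    (\<forall>W. min_cover V E W \<longrightarrow> scarf_boundary V E edge_sign f W = of_bool (W = W1) - of_bool (W = W2))"
proof -
  \<comment> \<open>The multiplier completes \<open>W\<close> to \<open>V - U\<close>; this is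
    possible exactly because \<open>W\<close> avoids \<open>U\<close>, and makes the image
    independent of \<open>W\<close>.\<close>
  define e where "e W = (\<lambda>\<sigma>. if \<sigma> = {sqfree W} then Poly_Mapping.single (sqfree (V - U - W)) 1 else 0 :: ('v, 'k) mpoly)" for W
  have e: "e W \<in> carrier (free_module (poly_ring V) (scarf_basis V E 1))"
    "taylor_diff ms (e W) {} = Poly_Mapping.single (sqfree (V - U)) 1"
    if W: "min_cover V E W" "W \<inter> U = {}" for W
  proof -
    have "sqfree ` {W} \<in> scarf_basis V E 1"
      unfolding scarf_basis_def using singleton_scarf[OF E_ne W(1)] by (intro imageI) simp
    then show c: "e W \<in> carrier (free_module (poly_ring V) (scarf_basis V E 1))"
      unfolding scarf_basis_carrier e_def using finite_V by auto
    have "taylor_diff ms (e W) {} = (\<Sum>W' | min_cover V E W'. if W' = W then Poly_Mapping.single (sqfree (V - U)) 1 else 0)"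
      unfolding taylor_diff_0[OF ms c E_ne]
    proof (rule sum.cong[OF refl])
      fix W' assume "W' \<in> Collect (min_cover V E)"
      moreover have "sqfree (V - U - W) + sqfree W = sqfree (V - U)"
        using sqfree_add_Diff[of "V - U" W] W finite_V min_cover_subset[OF W(1)] by (auto simp: add.commute)
      ultimately show "e W {sqfree W'} * Poly_Mapping.single (sqfree W') 1 =
          (if W' = W then Poly_Mapping.single (sqfree (V - U)) 1 else 0)"
        using W(1) finite_cover by (simp add: e_def mult_single)
    qed
    also have "\<dots> = Poly_Mapping.single (sqfree (V - U)) 1"
      using W(1) finite_min_covers by simp
    finally show "taylor_diff ms (e W) {} = Poly_Mapping.single (sqfree (V - U)) 1" .
  qed
  let ?c = "\<lambda>\<sigma>. e W1 \<sigma> - e W2 \<sigma>"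
  have c: "?c \<in> carrier (free_module (poly_ring V) (scarf_basis V E 1))"
    using e(1)[OF W1] e(1)[OF W2] unfolding scarf_basis_carrier
    by (intro conjI allI impI poly_carrier_diff) simp_all
  have "taylor_diff ms ?c \<tau> = 0" for \<tau>
  proof (cases "\<tau> = {}")
    case True
    have "taylor_diff ms ?c \<tau> = taylor_diff ms (e W1) \<tau> - taylor_diff ms (e W2) \<tau>"
      unfolding taylor_diff_def by (simp add: left_diff_distrib sum_subtractf)
    then show ?thesis
      using e(2)[OF W1] e(2)[OF W2] True by simp
  next
    case False
    have "taylor_diff ms ?c \<in> carrier (free_module (poly_ring V) (scarf_basis V E 0))"
      by (rule taylor_diff_carrier[OF ms]) (use c in simp)
    moreover have "\<tau> \<notin> scarf_basis V E 0"
      using False finite_scarf unfolding scarf_basis_def by auto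
    ultimately show ?thesis
      unfolding scarf_basis_carrier by blast
  qed
  then have "taylor_diff ms ?c = (\<lambda>_. 0)"
    by (rule ext)
  with c have "?c \<in> taylor_diff ms ` carrier (free_module (poly_ring V) (scarf_basis V E 2))"
    unfolding exact by (intro CollectI conjI)
  then obtain p where p': "?c = taylor_diff ms p" "p \<in> carrier (free_module (poly_ring V) (scarf_basis V E 2))"
    by (rule imageE)
  note p = p'(2) p'(1)[symmetric]
  \<comment> \<open>A pair already carries the degree \<open>\<Union>\<W>\<close>, so the
    coefficient to read off is that of the remaining vertices of \<open>V - U\<close>. Pairs that
    meet \<open>U\<close> cannot occur in this degree and get 0.\<close>
  define f where "f \<W> = (if \<Union>\<W> \<inter> U = {} then Poly_Mapping.lookup (p (sqfree ` \<W>)) (sqfree (V - U - \<Union>\<W>)) else 0)" for \<W>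
  have "scarf_boundary V E edge_sign f W = of_bool (W = W1) - of_bool (W = W2)" if W: "min_cover V E W" for W
  proof (cases "W \<inter> U = {}")
    case False
    then have "scarf_boundary V E edge_sign f W = 0"
      unfolding scarf_boundary_def f_def by (intro sum.neutral) auto
    then show ?thesis
      using False W1(2) W2(2) by auto
  next
    case True
    have "scarf_boundary V E edge_sign f W = Poly_Mapping.lookup (taylor_diff ms p {sqfree W}) (sqfree (V - U - W))"
      unfolding taylor_diff_1[OF ms p(1) W] lookup_sum scarf_boundary_def
    proof (rule sum.cong[OF refl])
      fix \<W> assume "\<W> \<in> {\<W> \<in> scarf_edges V E. W \<in> \<W>}"
      then have \<W>: "\<W> \<in> scarf_edges V E" "W \<in> \<W>"
        by auto
      have fin: "finite (\<Union>\<W> - W)" "finite (V - U - \<Union>\<W>)"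
        using finite_V finite_subset[OF scarf_edge_Union_subset[OF \<W>(1)]] by auto
      show "edge_sign \<W> W * f \<W> = Poly_Mapping.lookup
          (p (sqfree ` \<W>) * Poly_Mapping.single (sqfree (\<Union>\<W> - W)) (edge_sign \<W> W)) (sqfree (V - U - W))"
      proof (cases "\<Union>\<W> \<inter> U = {}")
        case disj: True
        have "V - U - W = (\<Union>\<W> - W) \<union> (V - U - \<Union>\<W>)"
          using disj \<W>(2) scarf_edge_Union_subset[OF \<W>(1)] by auto
        then have "sqfree (V - U - W) = sqfree (\<Union>\<W> - W) + sqfree (V - U - \<Union>\<W>)"
          using fin by (simp only:) (rule sqfree_Un, auto)
        then show ?thesis
          using disj by (simp add: f_def mult.commute[of "p _"])
      next
        case False
        then obtain u where u: "u \<in> \<Union>\<W>" "u \<in> U" by blast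
        \<comment> \<open>The variable \<open>u\<close> divides the weight of this pair but not the
          monomial whose coefficient is taken, so the pair contributes nothing.\<close>
        have "sqfree (V - U - W) \<noteq> sqfree (\<Union>\<W> - W) + n" for n
        proof
          assume "sqfree (V - U - W) = sqfree (\<Union>\<W> - W) + n"
          then have "Poly_Mapping.lookup (sqfree (V - U - W)) u = Poly_Mapping.lookup (sqfree (\<Union>\<W> - W)) u + Poly_Mapping.lookup n u"
            by (simp add: lookup_add)
          then show False
            using u True fin finite_V by auto
        qed
        then show ?thesis
          using False by (simp add: f_def mult.commute[of "p _"] lookup_single_mult_eq_0)
      qed
    qed
    also have "\<dots> = of_bool (W = W1) - of_bool (W = W2)"
      unfolding p(2) e_def using W W1(1) W2(1) finite_cover by (auto simp: lookup_minus)
    finally show ?thesis .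
  qed
  moreover have "\<Union>\<W> \<inter> U = {}" if "f \<W> \<noteq> 0" for \<W>
    using that by (auto simp: f_def split: if_splits)
  ultimately show ?thesis
    by blast
qed

text \<open>Multiplying the value at each pair by the missing vertices makes the chain homogeneous
  of the multidegree of \<open>V\<close>. Its differential at \<open>W\<close> is then the monomial
  of \<open>V - W\<close> times the boundary of \<open>f\<close> at \<open>W\<close>, so a cycle
  gives an element of the kernel.\<close>

lemma scarf_chain_acyclic:
  fixes f :: "'v set set \<Rightarrow> 'k::field"
  assumes injective: "\<And>c. c \<in> carrier (free_module (poly_ring V :: ('v, 'k) mpoly ring) (scarf_basis V E 2)) \<Longrightarrow>
      taylor_diff ms c = (\<lambda>_. 0) \<Longrightarrow> c = (\<lambda>_. 0)"
    and cycle: "\<forall>W. min_cover V E W \<longrightarrow> scarf_boundary V E edge_sign f W = 0"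
    and \<W>: "\<W> \<in> scarf_edges V E"
  shows "f \<W> = 0"
proof -
  \<comment> \<open>\<open>Poly_Mapping.keys\<close> recovers a cover from its monomial, so that
    \<open>f\<close> can be evaluated at a set of monomials.\<close>
  define p where "p \<sigma> = (if \<sigma> \<in> scarf_basis V E 2 then
    Poly_Mapping.single (sqfree (V - \<Union>(Poly_Mapping.keys ` \<sigma>))) (f (Poly_Mapping.keys ` \<sigma>)) else 0)" for \<sigma> :: "'v mon set"
  have p: "p \<in> carrier (free_module (poly_ring V) (scarf_basis V E 2))"
    unfolding scarf_basis_carrier p_def using finite_V by auto
  have p_edge: "p (sqfree ` \<W>) = Poly_Mapping.single (sqfree (V - \<Union>\<W>)) (f \<W>)" if "\<W> \<in> scarf_edges V E" for \<W>
  proof -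
    have covers: "\<W> \<subseteq> Collect (min_cover V E)"
      using that by (rule scarf_edge_subset)
    then have "Poly_Mapping.keys ` sqfree ` \<W> = id ` \<W>"
      using finite_cover unfolding image_image by (intro image_cong) auto
    then show ?thesis
      using that sqfree_scarf_edge_iff[OF covers] by (simp add: p_def)
  qed
  have "taylor_diff ms p \<tau> = 0" for \<tau>
  proof (cases "\<tau> \<in> scarf_basis V E 1")
    case True
    then obtain \<T> where \<T>: "\<tau> = sqfree ` \<T>" "\<T> \<in> scarf_family V E" "card \<T> = 1"
      unfolding scarf_basis_def by blast
    then obtain W where W: "\<T> = {W}"
      by (auto simp: card_1_singleton_iff)
    have mc: "min_cover V E W"
      using \<T>(2) W scarf_family_covers by auto
    have "taylor_diff ms p {sqfree W} =
        (\<Sum>\<W> | \<W> \<in> scarf_edges V E \<and> W \<in> \<W>. Poly_Mapping.single (sqfree (V - W)) (edge_sign \<W> W * f \<W>))"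
      unfolding taylor_diff_1[OF ms p mc]
    proof (rule sum.cong[OF refl])
      fix \<W> assume "\<W> \<in> {\<W> \<in> scarf_edges V E. W \<in> \<W>}"
      then have \<W>: "\<W> \<in> scarf_edges V E" "W \<in> \<W>"
        by auto
      have sub: "\<Union>\<W> \<subseteq> V"
        using \<W>(1) by (rule scarf_edge_Union_subset)
      then have fin: "finite (\<Union>\<W> - W)" "finite (V - \<Union>\<W>)"
        using finite_V finite_subset[OF sub] by simp_all
      have "V - W = (V - \<Union>\<W>) \<union> (\<Union>\<W> - W)"
        using sub \<W>(2) by auto
      then have "sqfree (V - W) = sqfree (V - \<Union>\<W>) + sqfree (\<Union>\<W> - W)"
        using fin by (simp only:) (rule sqfree_Un, auto)
      then show "p (sqfree ` \<W>) * Poly_Mapping.single (sqfree (\<Union>\<W> - W)) (edge_sign \<W> W) =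
          Poly_Mapping.single (sqfree (V - W)) (edge_sign \<W> W * f \<W>)"
        by (simp add: p_edge[OF \<W>(1)] mult_single mult.commute)
    qed
    also have "\<dots> = Poly_Mapping.single (sqfree (V - W)) (scarf_boundary V E edge_sign f W)"
      unfolding scarf_boundary_def by (rule poly_mapping_eqI) (auto simp: lookup_sum lookup_single when_def)
    finally show ?thesis
      using cycle mc \<T>(1) W by simp
  next
    case False
    have "p \<in> carrier (free_module (poly_ring V) (scarf_basis V E (Suc 1)))"
      using p by (simp add: numeral_2_eq_2)
    from taylor_diff_carrier[OF ms this] show ?thesis
      using False unfolding scarf_basis_carrier by blast
  qed
  then have "p = (\<lambda>_. 0)"
    using injective[OF p] by blast
  then have "Poly_Mapping.single (sqfree (V - \<Union>\<W>)) (f \<W>) = 0"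
    using p_edge[OF \<W>] by simp
  then show ?thesis
    by (metis lookup_single_eq lookup_zero)
qed

end

text \<open>A larger face would contain a Scarf triple. The complex therefore ends in degree 2, and
  exactness there is injectivity.\<close>

lemma scarf_basis_ge_3:
  assumes "3 \<le> i"
  shows "scarf_basis V E i = {}"
proof -
  have False if \<W>: "\<W> \<in> scarf_family V E" "card \<W> = i" for \<W>
  proof -
    obtain \<T> where "\<T> \<subseteq> \<W>" "card \<T> = 3"
      using obtain_subset_with_card_n[of 3 \<W>] \<W>(2) assms by metis
    then show False
      using no_scarf_triple scarf_family_subset[OF \<W>(1)] by blast
  qed
  then show ?thesis
    unfolding scarf_basis_def by blast
qed

lemma partition_of_scarf_ideal:
  assumes "scarf_ideal V (cover_ideal V E :: ('v, 'k::field) mpoly set)" "chordal V E" "E \<noteq> {}"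
  shows "\<exists>A B. A \<union> B = V \<and> A \<inter> B = {} \<and> clique A E \<and> indep B E \<and>
       (\<forall>x\<in>A. \<exists>y\<in>B. {x, y} \<in> E) \<and>
       (\<forall>x\<in>A. \<forall>x'\<in>A. x \<noteq> x' \<longrightarrow> \<not> nbhd V E x \<inter> B \<subseteq> nbhd V E x' \<inter> B)"
proof -
  let ?R = "poly_ring V :: ('v, 'k) mpoly ring"
  let ?F = "\<lambda>i. free_module ?R (scarf_basis V E i)"
  let ?J = "cover_ideal V E :: ('v, 'k) mpoly set"
  obtain ms where res: "distinct ms \<and> set ms = mingens ?J \<and>
      minimal_free_resolution ?R (irrelevant_ideal V) (quotient_module ?R ?J) (scarf_basis V E)
        (\<lambda>i. taylor_diff ms) (\<lambda>c. ?J +>\<^bsub>?R\<^esub> c {})"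
    using assms(1) unfolding scarf_ideal_def scarf_basis_eq by (rule exE)
  then have ms: "distinct ms" "set ms = sqfree ` Collect (min_cover V E)"
    by (simp_all add: mingens_cover_ideal)
  \<comment> \<open>The index is shifted: \<open>i = 0\<close> is exactness at the generators, and
    \<open>i = 1\<close> is exactness at the pairs, where the module mapping into them is
    zero.\<close>
  have ker: "taylor_diff ms ` carrier (?F (Suc (Suc i))) = module_ker (?F (Suc i)) (?F i) (taylor_diff ms)" for i
    using res by (simp add: minimal_free_resolution_def free_resolution_def Let_def)
  have zero: "\<zero>\<^bsub>?F i\<^esub> = (\<lambda>_. 0)" for i
    by (simp add: free_module_def)
  have exact: "taylor_diff ms ` carrier (?F 2) = {c \<in> carrier (?F 1). taylor_diff ms c = (\<lambda>_. 0)}"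
    using ker[of 0] by (simp add: module_ker_def zero numeral_2_eq_2)
  have injective: "c = (\<lambda>_. 0)" if "c \<in> carrier (?F 2)" "taylor_diff ms c = (\<lambda>_. 0)" for c
  proof -
    have "c \<in> taylor_diff ms ` carrier (?F 3)"
      using ker[of 1] that by (simp add: module_ker_def zero numeral_2_eq_2 numeral_3_eq_3)
    moreover have "carrier (?F 3) \<subseteq> {\<lambda>_. 0}"
      unfolding scarf_basis_ge_3[OF order_refl] by (auto simp: free_module_carrier_iff)
    moreover have "taylor_diff ms (\<lambda>_. 0) = (\<lambda>_. 0 :: ('v, 'k) mpoly)"
      by (simp add: taylor_diff_def)
    ultimately show ?thesis
      by blast
  qed
  show ?thesis
  proof (rule partition_of_scarf_tree[OF _ _ _ assms(2)])
    show "taylor_sign ms (sqfree ` {W1, W2}) (sqfree W1) = - (taylor_sign ms (sqfree ` {W1, W2}) (sqfree W2) :: 'k)"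
      if "min_cover V E W1" "min_cover V E W2" "W1 \<noteq> W2" for W1 W2
      using edge_sign_swap[OF ms assms(3) that] .
  next
    fix W1 W2 U assume "min_cover V E W1" "min_cover V E W2" "W1 \<inter> U = {}" "W2 \<inter> U = {}"
    then show "\<exists>f :: 'v set set \<Rightarrow> 'k. (\<forall>\<W>. f \<W> \<noteq> 0 \<longrightarrow> \<Union>\<W> \<inter> U = {}) \<and>
        (\<forall>W. min_cover V E W \<longrightarrow> scarf_boundary V E (\<lambda>\<W> W. taylor_sign ms (sqfree ` \<W>) (sqfree W)) f W
          = of_bool (W = W1) - of_bool (W = W2))"
      using scarf_chain_connected[OF ms assms(3) exact] by blast
  next
    show "\<forall>f :: 'v set set \<Rightarrow> 'k. (\<forall>W. min_cover V E W \<longrightarrow>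
        scarf_boundary V E (\<lambda>\<W> W. taylor_sign ms (sqfree ` \<W>) (sqfree W)) f W = 0) \<longrightarrow>
        (\<forall>\<W>\<in>scarf_edges V E. f \<W> = 0)"
      using scarf_chain_acyclic[OF ms assms(3) injective] by blast
  qed
qed

end


section \<open>The star-shaped resolution of a split graph\<close>

lemma single_mult_eq_0:
  fixes p :: "('v, 'k::field) mpoly"
  assumes "p * Poly_Mapping.single m c = 0" "c \<noteq> 0"
  shows "p = 0"
proof (rule poly_mapping_eqI)
  fix n
  have "Poly_Mapping.lookup (Poly_Mapping.single m c * p) (m + n) = 0"
    using assms(1) by (simp only: mult.commute lookup_zero)
  then show "Poly_Mapping.lookup p n = Poly_Mapping.lookup 0 n"
    using assms(2) by simp
qed

lemma mon_dvd_diff_add: "mon_dvd m n \<Longrightarrow> n - m + m = n"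
  by (auto simp: mon_dvd_def add.commute)

text \<open>The quotient is formed term by term; divisibility makes the truncated subtraction of
  exponents exact.\<close>

lemma single_dividesE:
  fixes p :: "('v, 'k::field) mpoly"
  assumes "\<And>n. n \<in> Poly_Mapping.keys p \<Longrightarrow> mon_dvd m n" "p \<in> carrier (poly_ring V)"
  obtains q where "q \<in> carrier (poly_ring V)" "p = q * Poly_Mapping.single m 1"
proof
  let ?q = "\<Sum>n\<in>Poly_Mapping.keys p. Poly_Mapping.single (n - m) (Poly_Mapping.lookup p n)"
  have "Poly_Mapping.keys (n - m) \<subseteq> V" if "n \<in> Poly_Mapping.keys p" for n
    using that assms mon_dvd_diff_add[of m n] keys_plus_mon[of "n - m" m] by auto
  then show "?q \<in> carrier (poly_ring V)"
    by (intro ideal_poly_sum[OF ring.oneideal[OF ring_poly_ring]]) simp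
  show "p = ?q * Poly_Mapping.single m 1"
    using assms(1) by (simp add: sum_distrib_right mult_single mon_dvd_diff_add poly_mapping_sum_single)
qed

lemma augmentation_hom:
  assumes I: "ideal I (poly_ring V :: ('v, 'k::field) mpoly ring)" and "b \<in> B"
  shows "(\<lambda>c. I +>\<^bsub>poly_ring V\<^esub> c b) \<in>
    module_hom (poly_ring V) (free_module (poly_ring V) B) (quotient_module (poly_ring V) I)"
proof -
  note hom = ideal.rcos_ring_hom[OF I]
  have c: "c b \<in> carrier (poly_ring V)" if "c \<in> carrier (free_module (poly_ring V) B)"
    for c :: "_ \<Rightarrow> ('v, 'k) mpoly"
    using that assms(2) by (simp add: free_module_def)
  show ?thesis
    unfolding module_hom_def
  proof (intro CollectI conjI ballI)
    show "(\<lambda>c. I +>\<^bsub>poly_ring V\<^esub> c b) \<in> carrier (free_module (poly_ring V) B) \<rightarrow> carrier (quotient_module (poly_ring V) I)"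
      using ring_hom_closed[OF hom] c by (auto simp: quotient_module_def simp del: poly_ring_simps)
  next
    fix x y :: "_ \<Rightarrow> ('v, 'k) mpoly"
    assume "x \<in> carrier (free_module (poly_ring V) B)" "y \<in> carrier (free_module (poly_ring V) B)"
    then show "I +>\<^bsub>poly_ring V\<^esub> (x \<oplus>\<^bsub>free_module (poly_ring V) B\<^esub> y) b =
        (I +>\<^bsub>poly_ring V\<^esub> x b) \<oplus>\<^bsub>quotient_module (poly_ring V) I\<^esub> (I +>\<^bsub>poly_ring V\<^esub> y b)"
      using ring_hom_add[OF hom c c] by (simp add: quotient_module_def free_module_def del: poly_ring_simps)
  next
    fix a :: "('v, 'k) mpoly" and x :: "_ \<Rightarrow> ('v, 'k) mpoly"
    assume "a \<in> carrier (poly_ring V)" "x \<in> carrier (free_module (poly_ring V) B)"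
    then show "I +>\<^bsub>poly_ring V\<^esub> (a \<odot>\<^bsub>free_module (poly_ring V) B\<^esub> x) b =
        a \<odot>\<^bsub>quotient_module (poly_ring V) I\<^esub> (I +>\<^bsub>poly_ring V\<^esub> x b)"
      using ring_hom_mult[OF hom _ c] by (simp add: quotient_module_def free_module_def del: poly_ring_simps)
  qed
qed

context simple_graph
begin

lemma empty_scarf: "E \<noteq> {} \<Longrightarrow> {} \<in> scarf_family V E"
proof -
  assume "E \<noteq> {}"
  have "indep {} E"
    by (simp add: indep_def)
  then obtain W where "min_cover V E W"
    by (rule min_cover_avoiding)
  then have "{W} \<in> scarf_family V E"
    using singleton_scarf \<open>E \<noteq> {}\<close> by blast
  then show ?thesis
    by (rule scarf_family_subset) simp
qed

lemma scarf_basis_0: "E \<noteq> {} \<Longrightarrow> scarf_basis V E 0 = {{}}"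
  using empty_scarf finite_scarf by (auto simp: scarf_basis_def)

lemma scarf_basis_1:
  assumes "E \<noteq> {}"
  shows "scarf_basis V E 1 = (\<lambda>W. {sqfree W}) ` Collect (min_cover V E)"
proof -
  have "{\<W> \<in> scarf_family V E. card \<W> = 1} = (\<lambda>W. {W}) ` Collect (min_cover V E)"
    using singleton_scarf[OF assms] scarf_family_covers by (auto simp: card_1_singleton_iff)
  then show ?thesis
    unfolding scarf_basis_def by (simp add: image_image)
qed

section \<open>Exactness at the ring and the composite of the first two differentials\<close>

context
  fixes ms :: "'v mon list"
  assumes ms: "distinct ms" "set ms = sqfree ` Collect (min_cover V E)"
    and E_ne: "E \<noteq> {}"
begin

lemma taylor_diff_hom:
  "taylor_diff ms \<in> module_hom (poly_ring V :: ('v, 'k::field) mpoly ring)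
    (free_module (poly_ring V) (scarf_basis V E (Suc i))) (free_module (poly_ring V) (scarf_basis V E i))"
  unfolding module_hom_def
proof (intro CollectI conjI ballI Pi_I)
  fix c assume "c \<in> carrier (free_module (poly_ring V :: ('v, 'k) mpoly ring) (scarf_basis V E (Suc i)))"
  then show "taylor_diff ms c \<in> carrier (free_module (poly_ring V) (scarf_basis V E i))"
    by (rule taylor_diff_carrier[OF ms])
qed (simp_all add: free_module_def taylor_diff_def distrib_right sum.distrib sum_distrib_left mult.assoc)

lemma taylor_diff_diff:
  "taylor_diff ms (\<lambda>\<sigma>. c \<sigma> - c' \<sigma>) \<tau> = taylor_diff ms c \<tau> - (taylor_diff ms c' \<tau> :: ('v, 'k::field) mpoly)"
  unfolding taylor_diff_def by (simp add: left_diff_distrib sum_subtractf)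

lemma taylor_diff_eq_0I:
  fixes c :: "'v mon set \<Rightarrow> ('v, 'k::field) mpoly"
  assumes "c \<in> carrier (free_module (poly_ring V) (scarf_basis V E 1))" "taylor_diff ms c {} = 0"
  shows "taylor_diff ms c = (\<lambda>_. 0)"
proof
  fix \<tau>
  have "taylor_diff ms c \<in> carrier (free_module (poly_ring V) (scarf_basis V E 0))"
    by (rule taylor_diff_carrier[OF ms]) (use assms(1) in simp)
  then show "taylor_diff ms c \<tau> = 0"
    using assms(2) unfolding scarf_basis_carrier by (cases "\<tau> = {}") (simp_all add: scarf_basis_0[OF E_ne])
qed

text \<open>For a preimage of an element of the ideal, every term \<open>m\<close> is charged to one
  minimal cover \<open>g m\<close> inside its support.\<close>

lemma taylor_diff_image_0:
  "taylor_diff ms ` carrier (free_module (poly_ring V) (scarf_basis V E 1)) =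
    {c \<in> carrier (free_module (poly_ring V :: ('v, 'k::field) mpoly ring) (scarf_basis V E 0)). c {} \<in> cover_ideal V E}"
proof (intro equalityI subsetI)
  fix c assume "c \<in> taylor_diff ms ` carrier (free_module (poly_ring V :: ('v, 'k) mpoly ring) (scarf_basis V E 1))"
  then obtain b where b: "c = taylor_diff ms b"
    "b \<in> carrier (free_module (poly_ring V :: ('v, 'k) mpoly ring) (scarf_basis V E 1))"
    by (rule imageE)
  have "c \<in> carrier (free_module (poly_ring V) (scarf_basis V E 0))"
    unfolding b(1) by (rule taylor_diff_carrier[OF ms]) (use b(2) in simp)
  moreover have "c {} \<in> cover_ideal V E"
    unfolding b(1) taylor_diff_0[OF ms b(2) E_ne]
  proof (intro ideal_poly_sum[OF cover_ideal_ideal] ideal_poly_mult[OF cover_ideal_ideal])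
    fix W assume "W \<in> Collect (min_cover V E)"
    then show "Poly_Mapping.single (sqfree W) 1 \<in> (cover_ideal V E :: ('v, 'k) mpoly set)"
      unfolding single_in_cover_ideal using finite_cover min_cover_imp_vertex_cover by simp
    show "b {sqfree W} \<in> carrier (poly_ring V)"
      using b(2) unfolding scarf_basis_carrier by blast
  qed
  ultimately show "c \<in> {c \<in> carrier (free_module (poly_ring V :: ('v, 'k) mpoly ring) (scarf_basis V E 0)). c {} \<in> cover_ideal V E}"
    by (intro CollectI conjI)
next
  fix c assume "c \<in> {c \<in> carrier (free_module (poly_ring V :: ('v, 'k) mpoly ring) (scarf_basis V E 0)). c {} \<in> cover_ideal V E}"
  then have c: "c \<in> carrier (free_module (poly_ring V) (scarf_basis V E 0))" "c {} \<in> cover_ideal V E"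
    by blast+
  let ?K = "Poly_Mapping.keys (c {})"
  have "\<exists>W. min_cover V E W \<and> W \<subseteq> Poly_Mapping.keys m" if "m \<in> ?K" for m
  proof -
    have "vertex_cover V E (Poly_Mapping.keys m)"
      using c(2) that unfolding cover_ideal_eq by blast
    then show ?thesis
      by (rule min_cover_below) blast
  qed
  then obtain g where g: "\<And>m. m \<in> ?K \<Longrightarrow> min_cover V E (g m)" "\<And>m. m \<in> ?K \<Longrightarrow> g m \<subseteq> Poly_Mapping.keys m"
    by metis
  have dvd: "m - sqfree (g m) + sqfree (g m) = m" if "m \<in> ?K" for m
    using g(2)[OF that] finite_cover[OF g(1)[OF that]]
    by (intro mon_dvd_diff_add) (auto simp: mon_dvd_iff in_keys_iff Suc_leI)
  \<comment> \<open>The coefficient at a cover collects the terms charged to it, each divided by the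
    generator of that cover.\<close>
  define b where "b \<sigma> = (\<Sum>m | m \<in> ?K \<and> \<sigma> = {sqfree (g m)}. Poly_Mapping.single (m - sqfree (g m)) (Poly_Mapping.lookup (c {}) m))" for \<sigma>
  have b: "b \<in> carrier (free_module (poly_ring V) (scarf_basis V E 1))"
    unfolding scarf_basis_carrier
  proof (intro conjI allI impI)
    fix \<sigma>
    have "Poly_Mapping.keys (m - sqfree (g m)) \<subseteq> V" if "m \<in> ?K" for m
    proof -
      have "Poly_Mapping.keys (m - sqfree (g m)) \<subseteq> Poly_Mapping.keys m"
        by (subst (2) dvd[OF that, symmetric]) (simp add: keys_plus_mon)
      also have "\<dots> \<subseteq> V"
        using c(2) that unfolding cover_ideal_eq by simp
      finally show ?thesis .
    qed
    then show "b \<sigma> \<in> carrier (poly_ring V)"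
      unfolding b_def by (intro ideal_poly_sum[OF ring.oneideal[OF ring_poly_ring]]) auto
    show "b \<sigma> = 0" if "\<sigma> \<notin> scarf_basis V E 1"
      unfolding b_def by (rule sum.neutral) (use that g(1) scarf_basis_1[OF E_ne] in auto)
  qed
  have "taylor_diff ms b {} = (\<Sum>W | min_cover V E W. \<Sum>m | m \<in> ?K \<and> g m = W. Poly_Mapping.single m (Poly_Mapping.lookup (c {}) m))"
    unfolding taylor_diff_0[OF ms b E_ne] b_def sum_distrib_right
  proof (intro sum.cong refl)
    fix W assume W: "W \<in> Collect (min_cover V E)"
    show "{m \<in> ?K. {sqfree W} = {sqfree (g m)}} = {m \<in> ?K. g m = W}"
      using W g(1) finite_cover by auto
    fix m assume "m \<in> {m \<in> ?K. g m = W}"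
    then show "Poly_Mapping.single (m - sqfree (g m)) (Poly_Mapping.lookup (c {}) m) * Poly_Mapping.single (sqfree W) 1 =
        Poly_Mapping.single m (Poly_Mapping.lookup (c {}) m)"
      using dvd[of m] by (auto simp: mult_single)
  qed
  also have "\<dots> = (\<Sum>m\<in>?K. Poly_Mapping.single m (Poly_Mapping.lookup (c {}) m))"
    using g(1) by (intro sum.group finite_min_covers) auto
  also have "\<dots> = c {}"
    by (rule poly_mapping_sum_single)
  finally have b0: "taylor_diff ms b {} = c {}" .
  have "taylor_diff ms b \<in> carrier (free_module (poly_ring V) (scarf_basis V E 0))"
    by (rule taylor_diff_carrier[OF ms]) (use b in simp)
  then have "taylor_diff ms b \<tau> = c \<tau>" for \<tau>
    using b0 c(1) unfolding scarf_basis_carrier by (cases "\<tau> = {}") (simp_all add: scarf_basis_0[OF E_ne])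
  then have "taylor_diff ms b = c"
    by (rule ext)
  then show "c \<in> taylor_diff ms ` carrier (free_module (poly_ring V) (scarf_basis V E 1))"
    using b by blast
qed

text \<open>After both differentials, either end of a pair contributes the coefficient of the pair
  times the monomial of its union. Summing pair by pair instead of cover by cover brings the two
  opposite signs together.\<close>

lemma taylor_diff_1_0:
  fixes c :: "'v mon set \<Rightarrow> ('v, 'k::field) mpoly"
  assumes c: "c \<in> carrier (free_module (poly_ring V) (scarf_basis V E 2))"
  shows "taylor_diff ms (taylor_diff ms c) = (\<lambda>_. 0)"
proof (rule taylor_diff_eq_0I)
  let ?s = "\<lambda>\<W> W. taylor_sign ms (sqfree ` \<W>) (sqfree W)"
  show d: "taylor_diff ms c \<in> carrier (free_module (poly_ring V) (scarf_basis V E 1))"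
    by (rule taylor_diff_carrier[OF ms]) (use c in \<open>simp add: numeral_2_eq_2\<close>)
  have "taylor_diff ms (taylor_diff ms c) {} = (\<Sum>W | min_cover V E W. \<Sum>\<W> | \<W> \<in> scarf_edges V E \<and> W \<in> \<W>.
      c (sqfree ` \<W>) * Poly_Mapping.single (sqfree (\<Union>\<W>)) (?s \<W> W))"
    unfolding taylor_diff_0[OF ms d E_ne]
  proof (rule sum.cong[OF refl])
    fix W assume "W \<in> Collect (min_cover V E)"
    then have W: "min_cover V E W" by simp
    show "taylor_diff ms c {sqfree W} * Poly_Mapping.single (sqfree W) 1 =
      (\<Sum>\<W> | \<W> \<in> scarf_edges V E \<and> W \<in> \<W>. c (sqfree ` \<W>) * Poly_Mapping.single (sqfree (\<Union>\<W>)) (?s \<W> W))"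
      unfolding taylor_diff_1[OF ms c W] sum_distrib_right
    proof (rule sum.cong[OF refl])
      fix \<W> assume \<W>: "\<W> \<in> {\<W> \<in> scarf_edges V E. W \<in> \<W>}"
      then have "sqfree (\<Union>\<W> - W) + sqfree W = sqfree (\<Union>\<W>)"
        using sqfree_add_Diff[of "\<Union>\<W>" W] finite_Union_covers[OF scarf_edge_subset[OF ms E_ne, of \<W>]]
        by (auto simp: add.commute)
      then show "c (sqfree ` \<W>) * Poly_Mapping.single (sqfree (\<Union>\<W> - W)) (?s \<W> W) * Poly_Mapping.single (sqfree W) 1 =
          c (sqfree ` \<W>) * Poly_Mapping.single (sqfree (\<Union>\<W>)) (?s \<W> W)"
        by (simp add: mult.assoc mult_single)
    qed
  qed
  also have "\<dots> = (\<Sum>\<W>\<in>scarf_edges V E. \<Sum>W | W \<in> Collect (min_cover V E) \<and> W \<in> \<W>.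
      c (sqfree ` \<W>) * Poly_Mapping.single (sqfree (\<Union>\<W>)) (?s \<W> W))"
    by (rule sum.swap_restrict[OF finite_min_covers finite_scarf_edges])
  also have "\<dots> = 0"
  proof (rule sum.neutral, rule ballI)
    fix \<W> assume "\<W> \<in> scarf_edges V E"
    then obtain W1 W2 where W: "\<W> = {W1, W2}" "W1 \<noteq> W2" "min_cover V E W1" "min_cover V E W2"
      by (rule scarf_edgeE)
    then have "{W. W \<in> Collect (min_cover V E) \<and> W \<in> \<W>} = {W1, W2}"
      by auto
    then show "(\<Sum>W | W \<in> Collect (min_cover V E) \<and> W \<in> \<W>. c (sqfree ` \<W>) * Poly_Mapping.single (sqfree (\<Union>\<W>)) (?s \<W> W)) = 0"
      using edge_sign_swap[OF ms E_ne W(3,4,2), where ?'k = 'k] W(1,2) by (simp add: single_uminus)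
  qed
  finally show "taylor_diff ms (taylor_diff ms c) {} = 0" .
qed

end

section \<open>The star of a split partition\<close>

context
  fixes A B :: "'v set"
  assumes split: "A \<union> B = V" "A \<inter> B = {}" "clique A E" "indep B E"
    and dom: "\<forall>x\<in>A. \<exists>y\<in>B. {x, y} \<in> E"
    and antichain: "\<forall>x\<in>A. \<forall>x'\<in>A. x \<noteq> x' \<longrightarrow> \<not> nbhd V E x \<inter> B \<subseteq> nbhd V E x' \<inter> B"
begin

abbreviation exchange :: "'v \<Rightarrow> 'v set" where
  "exchange a \<equiv> A - {a} \<union> nbhd V E a \<inter> B"

lemma covers: "Collect (min_cover V E) = insert A (exchange ` A)"
  by (rule split_min_covers[OF split dom])

lemma min_cover_split_iff: "min_cover V E W \<longleftrightarrow> W \<in> insert A (exchange ` A)"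
  unfolding covers[symmetric] by simp

lemma cover_A: "min_cover V E A"
  unfolding min_cover_split_iff by (rule insertI1)

lemma cover_exchange: "a \<in> A \<Longrightarrow> min_cover V E (exchange a)"
  unfolding min_cover_split_iff by (intro insertI2 imageI)

lemma exchange_ne: "a \<in> A \<Longrightarrow> exchange a \<noteq> A"
  using split(2) by auto

lemma mem_exchange: "a \<in> A \<Longrightarrow> a \<in> exchange b \<longleftrightarrow> a \<noteq> b"
  using split(2) by auto

lemma exchange_inj: "a \<in> A \<Longrightarrow> b \<in> A \<Longrightarrow> exchange a = exchange b \<longleftrightarrow> a = b"
  using mem_exchange by metis

lemma scarf_edges_split: "scarf_edges V E = (\<lambda>a. {A, exchange a}) ` A"
proof (intro equalityI subsetI)
  fix \<W> assume \<W>: "\<W> \<in> scarf_edges V E"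
  then obtain W where W: "\<W> = {A, W}" "W \<noteq> A" "min_cover V E W"
    by (rule scarf_edge_containingE[OF _ split_scarf_edge[OF split dom \<W>]])
  have "W \<in> insert A (exchange ` A)"
    unfolding covers[symmetric] using W(3) by simp
  then have "W \<in> exchange ` A"
    using W(2) by (metis insertE)
  then obtain a where "W = exchange a" "a \<in> A"
    by (rule imageE)
  then show "\<W> \<in> (\<lambda>a. {A, exchange a}) ` A"
    unfolding W(1) by (intro rev_image_eqI[of a]) simp_all
next
  fix \<W> assume "\<W> \<in> (\<lambda>a. {A, exchange a}) ` A"
  then obtain a where a: "\<W> = {A, exchange a}" "a \<in> A"
    by (rule imageE)
  have unique: "\<T> = {A, exchange a}" if \<T>: "\<T> \<subseteq> Collect (min_cover V E)" "\<Union>\<T> = \<Union>{A, exchange a}" for \<T>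
  proof -
    have sub: "T = A \<or> T = exchange a" if T: "T \<in> \<T>" for T
    proof -
      have "T \<in> insert A (exchange ` A)"
        unfolding covers[symmetric] using T \<T>(1) by (rule rev_subsetD)
      then show ?thesis
      proof (rule insertE)
        assume "T \<in> exchange ` A"
        then obtain b where 2: "T = exchange b" "b \<in> A"
          by (rule imageE)
        have "T \<subseteq> A \<union> exchange a"
          using T \<T>(2) by auto
        then have "nbhd V E b \<inter> B \<subseteq> nbhd V E a \<inter> B"
          using 2(1) split(2) by auto
        then show ?thesis
          using antichain 2 a(2) by metis
      qed simp
    qed
    have "A \<in> \<T>"
    proof (rule ccontr)
      assume "A \<notin> \<T>"
      then have "\<Union>\<T> \<subseteq> exchange a"
        using sub by (metis Sup_least order_refl)
      moreover have "a \<in> \<Union>\<T>"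
        unfolding \<T>(2) using a(2) by simp
      ultimately show False
        using a(2) mem_exchange[of a a] by blast
    qed
    moreover have "exchange a \<in> \<T>"
    proof (rule ccontr)
      assume "exchange a \<notin> \<T>"
      then have "\<Union>\<T> \<subseteq> A"
        using sub by (metis Sup_least order_refl)
      moreover obtain y where "y \<in> B" "{a, y} \<in> E"
        using dom a(2) by metis
      then have "y \<in> \<Union>\<T>" "y \<notin> A"
        unfolding \<T>(2) using edgeD[of a y] split(2) by (auto simp: nbhd_def)
      ultimately show False
        by blast
    qed
    ultimately have "{A, exchange a} \<subseteq> \<T>"
      by (intro insert_subsetI empty_subsetI)
    moreover have "\<T> \<subseteq> {A, exchange a}"
      using sub by (intro subsetI) simp
    ultimately show ?thesis
      by (rule equalityI[rotated])
  qed
  have "\<W> \<in> scarf_family V E"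
    unfolding scarf_family_def a(1) mem_Collect_eq
  proof (intro conjI allI impI)
    show "{A, exchange a} \<subseteq> Collect (min_cover V E)"
      using cover_A cover_exchange[OF a(2)] by simp
    fix \<T> assume "\<T> \<subseteq> Collect (min_cover V E) \<and> \<Union>\<T> = \<Union>{A, exchange a}"
    then show "\<T> = {A, exchange a}"
      by (elim conjE) (rule unique)
  qed
  moreover have "card \<W> = 2"
    unfolding a(1) using exchange_ne[OF a(2)] by simp
  ultimately show "\<W> \<in> scarf_edges V E"
    by (simp add: scarf_edges_def)
qed

text \<open>\<open>exchange a\<close> is a leaf of the star: it differs from the centre
  \<open>A\<close> and determines \<open>a\<close>.\<close>

lemma scarf_edges_containing:
  "a \<in> A \<Longrightarrow> {\<W>. \<W> \<in> scarf_edges V E \<and> exchange a \<in> \<W>} = {{A, exchange a}}"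
proof (intro equalityI subsetI)
  fix \<W> assume a: "a \<in> A" and "\<W> \<in> {\<W>. \<W> \<in> scarf_edges V E \<and> exchange a \<in> \<W>}"
  then obtain b where b: "\<W> = {A, exchange b}" "b \<in> A" "exchange a \<in> \<W>"
    unfolding scarf_edges_split by auto
  then have "a = b"
    using a exchange_ne[OF a] exchange_inj[OF a b(2)] by (metis empty_iff insert_iff)
  then show "\<W> \<in> {{A, exchange a}}"
    using b(1) by simp
next
  fix \<W> assume "a \<in> A" "\<W> \<in> {{A, exchange a}}"
  then show "\<W> \<in> {\<W>. \<W> \<in> scarf_edges V E \<and> exchange a \<in> \<W>}"
    unfolding scarf_edges_split by simp
qed

text \<open>The differential of a pair at its leaf is thus the variable \<open>a\<close> up to
  sign.\<close>

lemma Union_edge_minus: "a \<in> A \<Longrightarrow> \<Union>{A, exchange a} - exchange a = {a}"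
  using split(2) by auto

context
  fixes ms :: "'v mon list"
  assumes ms: "distinct ms" "set ms = sqfree ` Collect (min_cover V E)"
    and E_ne: "E \<noteq> {}"
begin

abbreviation star_sign :: "'v \<Rightarrow> 'k::field" where
  "star_sign a \<equiv> taylor_sign ms (sqfree ` {A, exchange a}) (sqfree (exchange a))"

lemma taylor_diff_1_exchange:
  fixes c :: "'v mon set \<Rightarrow> ('v, 'k::field) mpoly"
  assumes "c \<in> carrier (free_module (poly_ring V) (scarf_basis V E 2))" "a \<in> A"
  shows "taylor_diff ms c {sqfree (exchange a)} =
    c (sqfree ` {A, exchange a}) * Poly_Mapping.single (sqfree {a}) (star_sign a)"
  unfolding taylor_diff_1[OF ms assms(1) cover_exchange[OF assms(2)]] scarf_edges_containing[OF assms(2)]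
  by (simp only: sum.insert finite.emptyI empty_iff not_False_eq_True sum.empty add_0_right
      Union_edge_minus[OF assms(2)])

lemma scarf_basis_2_split: "scarf_basis V E 2 = (\<lambda>a. sqfree ` {A, exchange a}) ` A"
  using scarf_edges_split unfolding scarf_basis_def scarf_edges_def by (simp only: image_image)

text \<open>The value at the leaf \<open>exchange a\<close> is the coefficient of a single pair
  times a nonzero monomial, so it determines this coefficient.\<close>

lemma taylor_diff_1_injective:
  fixes c :: "'v mon set \<Rightarrow> ('v, 'k::field) mpoly"
  assumes c: "c \<in> carrier (free_module (poly_ring V) (scarf_basis V E 2))" and "taylor_diff ms c = (\<lambda>_. 0)"
  shows "c = (\<lambda>_. 0)"
proof
  fix \<sigma>
  show "c \<sigma> = 0"
  proof (cases "\<sigma> \<in> scarf_basis V E 2")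
    case True
    then obtain a where a: "\<sigma> = sqfree ` {A, exchange a}" "a \<in> A"
      unfolding scarf_basis_2_split by (rule imageE)
    have "c \<sigma> * Poly_Mapping.single (sqfree {a}) (star_sign a) = 0"
      using taylor_diff_1_exchange[OF c a(2)] assms(2) unfolding a(1) by metis
    then show ?thesis
      by (rule single_mult_eq_0) (simp add: taylor_sign_def)
  next
    case False
    then show ?thesis
      using c unfolding scarf_basis_carrier by blast
  qed
qed

text \<open>Every generator other than the one of \<open>exchange a\<close> is divisible by the variable \<open>a\<close>, hence so is
  the coefficient at \<open>exchange a\<close> of a syzygy.\<close>

lemma syzygy_dividesE:
  fixes c :: "'v mon set \<Rightarrow> ('v, 'k::field) mpoly"
  assumes c: "c \<in> carrier (free_module (poly_ring V) (scarf_basis V E 1))" and syz: "taylor_diff ms c {} = 0"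
    and a: "a \<in> A"
  obtains q where "q \<in> carrier (poly_ring V)" "c {sqfree (exchange a)} = q * Poly_Mapping.single (sqfree {a}) 1"
proof (rule single_dividesE)
  let ?W = "exchange a"
  show "c {sqfree ?W} \<in> carrier (poly_ring V)"
    using c unfolding scarf_basis_carrier by blast
  fix n assume n: "n \<in> Poly_Mapping.keys (c {sqfree ?W})"
  have "a \<in> Poly_Mapping.keys n"
  proof (rule ccontr)
    assume "a \<notin> Poly_Mapping.keys n"
    then have na: "Poly_Mapping.lookup n a = 0"
      by (simp add: in_keys_iff)
    \<comment> \<open>The syzygy is compared at the exponent \<open>?k\<close>, in which
      \<open>a\<close> does not occur. Every other cover contains \<open>a\<close>, so only
      \<open>exchange a\<close> contributes, namely the coefficient of \<open>n\<close>.\<close>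
    let ?k = "sqfree ?W + n"
    have fin: "finite ?W"
      using finite_cover[OF cover_exchange[OF a]] .
    have "0 = (\<Sum>W | min_cover V E W. Poly_Mapping.lookup (c {sqfree W} * Poly_Mapping.single (sqfree W) 1) ?k)"
      using syz unfolding taylor_diff_0[OF ms c E_ne] lookup_sum[symmetric] by simp
    also have "\<dots> = (\<Sum>W | min_cover V E W. if W = ?W then Poly_Mapping.lookup (c {sqfree ?W}) n else 0)"
    proof (rule sum.cong[OF refl])
      fix W assume W: "W \<in> Collect (min_cover V E)"
      show "Poly_Mapping.lookup (c {sqfree W} * Poly_Mapping.single (sqfree W) 1) ?k =
          (if W = ?W then Poly_Mapping.lookup (c {sqfree ?W}) n else 0)"
      proof (cases "W = ?W")
        case True
        then show ?thesis
          by (simp add: mult.commute[of "c _"])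
      next
        case False
        have "W \<in> insert A (exchange ` A)"
          using W unfolding covers .
        then have "a \<in> W"
        proof (rule insertE)
          assume "W \<in> exchange ` A"
          then obtain b where "W = exchange b" "b \<in> A"
            by (rule imageE)
          then show "a \<in> W"
            using False mem_exchange[OF a] by metis
        qed (use a in simp)
        have "?k \<noteq> sqfree W + r" for r
        proof
          assume "?k = sqfree W + r"
          then have "Poly_Mapping.lookup ?k a = Poly_Mapping.lookup (sqfree W) a + Poly_Mapping.lookup r a"
            by (simp add: lookup_add)
          moreover have "Poly_Mapping.lookup ?k a = 0"
            using na fin mem_exchange[OF a, of a] by (simp only: lookup_add lookup_sqfree) simp
          moreover have "Poly_Mapping.lookup (sqfree W) a = 1"
            using \<open>a \<in> W\<close> W finite_cover by simp
          ultimately show False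
            by simp
        qed
        then show ?thesis
          using False by (simp add: mult.commute[of "c _"] lookup_single_mult_eq_0)
      qed
    qed
    also have "\<dots> = Poly_Mapping.lookup (c {sqfree ?W}) n"
      using finite_min_covers cover_exchange[OF a] by simp
    finally show False
      using n by (simp add: in_keys_iff)
  qed
  then show "mon_dvd (sqfree {a}) n"
    by (auto simp: mon_dvd_iff in_keys_iff Suc_leI)
qed

text \<open>Given a syzygy, dividing its leaf coefficients by the variables yields an element
  \<open>p\<close> whose differential agrees with it at all leaves. The difference is a syzygy
  supported at the centre \<open>A\<close> alone, hence zero.\<close>

lemma taylor_diff_image_1:
  "taylor_diff ms ` carrier (free_module (poly_ring V) (scarf_basis V E 2)) =
    {c \<in> carrier (free_module (poly_ring V :: ('v, 'k::field) mpoly ring) (scarf_basis V E 1)). taylor_diff ms c = (\<lambda>_. 0)}"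
proof (intro equalityI subsetI)
  fix c assume "c \<in> taylor_diff ms ` carrier (free_module (poly_ring V :: ('v, 'k) mpoly ring) (scarf_basis V E 2))"
  then obtain b where b: "c = taylor_diff ms b"
    "b \<in> carrier (free_module (poly_ring V :: ('v, 'k) mpoly ring) (scarf_basis V E 2))"
    by (rule imageE)
  have "c \<in> carrier (free_module (poly_ring V) (scarf_basis V E 1))"
    unfolding b(1) by (rule taylor_diff_carrier[OF ms]) (use b(2) in \<open>simp add: numeral_2_eq_2\<close>)
  then show "c \<in> {c \<in> carrier (free_module (poly_ring V :: ('v, 'k) mpoly ring) (scarf_basis V E 1)). taylor_diff ms c = (\<lambda>_. 0)}"
    using taylor_diff_1_0[OF ms E_ne b(2)] unfolding b(1) by (intro CollectI conjI)
next
  fix c assume "c \<in> {c \<in> carrier (free_module (poly_ring V :: ('v, 'k) mpoly ring) (scarf_basis V E 1)). taylor_diff ms c = (\<lambda>_. 0)}"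
  then have c: "c \<in> carrier (free_module (poly_ring V :: ('v, 'k) mpoly ring) (scarf_basis V E 1))"
    and syz: "taylor_diff ms c {} = 0"
    by simp_all
  have "\<exists>q. q \<in> carrier (poly_ring V) \<and> c {sqfree (exchange a)} = q * Poly_Mapping.single (sqfree {a}) 1" if "a \<in> A" for a
    using that by (rule syzygy_dividesE[OF c syz]) blast
  then obtain q where q: "\<And>a. a \<in> A \<Longrightarrow> q a \<in> carrier (poly_ring V)"
    "\<And>a. a \<in> A \<Longrightarrow> c {sqfree (exchange a)} = q a * Poly_Mapping.single (sqfree {a}) 1"
    by metis
  \<comment> \<open>At most one \<open>a\<close> belongs to a given \<open>\<sigma>\<close>, so the
    sum merely selects it. The sign is inserted as a constant polynomial and cancels the one in the
    differential, its square being 1.\<close>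
  define p where "p \<sigma> = (\<Sum>a | a \<in> A \<and> \<sigma> = sqfree ` {A, exchange a}. Poly_Mapping.single 0 (star_sign a) * q a)" for \<sigma>
  have p: "p \<in> carrier (free_module (poly_ring V) (scarf_basis V E 2))"
    unfolding scarf_basis_carrier
  proof (intro conjI allI impI)
    fix \<sigma>
    show "p \<sigma> \<in> carrier (poly_ring V)"
      unfolding p_def using q(1)
      by (intro ideal_poly_sum[OF ring.oneideal[OF ring_poly_ring]] poly_carrier_mult) auto
    show "p \<sigma> = 0" if "\<sigma> \<notin> scarf_basis V E 2"
      unfolding p_def by (rule sum.neutral) (use that scarf_basis_2_split in auto)
  qed
  have p_edge: "p (sqfree ` {A, exchange a}) = Poly_Mapping.single 0 (star_sign a) * q a" if a: "a \<in> A" for a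
  proof -
    have "b = a" if "b \<in> A" "sqfree ` {A, exchange a} = sqfree ` {A, exchange b}" for b
    proof -
      have "{A, exchange a} = {A, exchange b}"
        using that(2) cover_A cover_exchange[OF a] cover_exchange[OF that(1)]
        by (subst (asm) sqfree_image_inj) simp_all
      then show ?thesis
        using exchange_ne[OF a] exchange_inj[OF a that(1)] by (metis doubleton_eq_iff)
    qed
    then have "{b \<in> A. sqfree ` {A, exchange a} = sqfree ` {A, exchange b}} = {a}"
      using a by blast
    then show ?thesis
      unfolding p_def by simp
  qed
  let ?r = "\<lambda>\<sigma>. c \<sigma> - taylor_diff ms p \<sigma>"
  have dp: "taylor_diff ms p \<in> carrier (free_module (poly_ring V) (scarf_basis V E 1))"
    by (rule taylor_diff_carrier[OF ms]) (use p in \<open>simp add: numeral_2_eq_2\<close>)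
  have r: "?r \<in> carrier (free_module (poly_ring V) (scarf_basis V E 1))"
    using c dp unfolding scarf_basis_carrier
    by (intro conjI allI impI poly_carrier_diff) simp_all
  have r_exchange: "?r {sqfree (exchange a)} = 0" if a: "a \<in> A" for a
    unfolding taylor_diff_1_exchange[OF p a] p_edge[OF a] q(2)[OF a]
    by (simp add: mult.commute[of _ "q a"] mult.assoc mult_single taylor_sign_square)
  \<comment> \<open>With all leaf coefficients zero, the syzygy relation reduces to its term at
    \<open>A\<close>, a coefficient times a monomial.\<close>
  have "0 = taylor_diff ms ?r {}"
    unfolding taylor_diff_diff[OF ms E_ne] taylor_diff_1_0[OF ms E_ne p] using syz by simp
  also have "\<dots> = (\<Sum>W | min_cover V E W. if W = A then ?r {sqfree A} * Poly_Mapping.single (sqfree A) 1 else 0)"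
    unfolding taylor_diff_0[OF ms r E_ne]
  proof (rule sum.cong[OF refl])
    fix W assume "W \<in> Collect (min_cover V E)"
    then have "W \<in> insert A (exchange ` A)"
      unfolding covers .
    then show "?r {sqfree W} * Poly_Mapping.single (sqfree W) 1 =
        (if W = A then ?r {sqfree A} * Poly_Mapping.single (sqfree A) 1 else 0)"
    proof (rule insertE)
      assume "W \<in> exchange ` A"
      then obtain a where "W = exchange a" "a \<in> A"
        by (rule imageE)
      then show ?thesis
        using r_exchange exchange_ne by (simp only: if_False mult_zero_left)
    qed simp
  qed
  also have "\<dots> = ?r {sqfree A} * Poly_Mapping.single (sqfree A) 1"
    using finite_min_covers cover_A by simp
  finally have "?r {sqfree A} * Poly_Mapping.single (sqfree A) 1 = 0"
    by (rule sym)
  then have r_A: "?r {sqfree A} = 0"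
    by (rule single_mult_eq_0) simp
  have "?r \<sigma> = 0" for \<sigma>
  proof (cases "\<sigma> \<in> scarf_basis V E 1")
    case True
    then have "\<sigma> \<in> (\<lambda>W. {sqfree W}) ` insert A (exchange ` A)"
      unfolding scarf_basis_1[OF E_ne] covers .
    then show ?thesis
      using r_A r_exchange by (elim imageE insertE) (simp_all only:)
  next
    case False
    then show ?thesis
      using r unfolding scarf_basis_carrier by blast
  qed
  then have "c = taylor_diff ms p"
    by (intro ext) (simp only: right_minus_eq)
  then show "c \<in> taylor_diff ms ` carrier (free_module (poly_ring V) (scarf_basis V E 2))"
    using p by (rule image_eqI)
qed

end

text \<open>Any enumeration of the generators serves. The partition enters through exactness at the
  generators and at the pairs, where the star computations apply.\<close>

lemma scarf_ideal_of_partition: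
  assumes E_ne: "E \<noteq> {}"
  shows "scarf_ideal V (cover_ideal V E :: ('v, 'k::field) mpoly set)"
proof -
  let ?R = "poly_ring V :: ('v, 'k) mpoly ring"
  let ?J = "cover_ideal V E :: ('v, 'k) mpoly set"
  let ?F = "\<lambda>i. free_module ?R (scarf_basis V E i)"
  have "finite (sqfree ` Collect (min_cover V E))"
    using finite_min_covers by simp
  from finite_distinct_list[OF this]
  obtain ms where ms: "distinct ms" "set ms = sqfree ` Collect (min_cover V E)"
    by blast
  have zero: "\<zero>\<^bsub>?F i\<^esub> = (\<lambda>_. 0)" for i
    by (simp add: free_module_def)
  have empty: "{} \<in> scarf_basis V E 0"
    by (simp add: scarf_basis_0[OF E_ne])
  have d0: "taylor_diff ms (\<lambda>_. 0) = (\<lambda>_. 0 :: ('v, 'k) mpoly)"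
    by (simp add: taylor_diff_def)
  have zero_carrier: "(\<lambda>_. 0) \<in> carrier (?F i)" for i
    unfolding scarf_basis_carrier by simp
  have carrier_ge_3: "carrier (?F i) = {\<lambda>_. 0}" if "3 \<le> i" for i
    unfolding scarf_basis_ge_3[OF that] by (auto simp: free_module_carrier_iff)
  have "taylor_diff ms ` carrier (?F (Suc (Suc i))) = module_ker (?F (Suc i)) (?F i) (taylor_diff ms)" for i
  proof -
    \<comment> \<open>Exactness at \<open>?F (Suc i)\<close>: syzygies of the generators for 0,
      injectivity on pairs for 1, and zero modules from 2 on.\<close>
    consider "i = 0" | "i = 1" | "2 \<le> i" by linarith
    then show ?thesis
    proof cases
      case 1
      then show ?thesis
        using taylor_diff_image_1[OF ms E_ne, where ?'k = 'k]
        by (simp add: module_ker_def zero numeral_2_eq_2)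
    next
      case 2
      have "module_ker (?F 2) (?F 1) (taylor_diff ms) = {\<lambda>_. 0}"
        unfolding module_ker_def zero using taylor_diff_1_injective[OF ms E_ne] zero_carrier d0 by blast
      then show ?thesis
        using 2 carrier_ge_3[of 3] d0 by (simp add: numeral_2_eq_2 numeral_3_eq_3)
    next
      case 3
      then show ?thesis
        using carrier_ge_3[of "Suc i"] carrier_ge_3[of "Suc (Suc i)"] d0 by (auto simp: module_ker_def zero)
    qed
  qed
  moreover have "taylor_diff ms ` carrier (?F 1) = module_ker (?F 0) (quotient_module ?R ?J) (\<lambda>c. ?J +>\<^bsub>?R\<^esub> c {})"
  proof -
    have "?J +>\<^bsub>?R\<^esub> x = ?J \<longleftrightarrow> x \<in> ?J" if "x \<in> carrier ?R" for x
      using ideal.rcos_const_imp_mem[OF cover_ideal_ideal that] ring.a_rcos_zero[OF ring_poly_ring cover_ideal_ideal] by blast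
    moreover have "c {} \<in> carrier ?R" if "c \<in> carrier (?F 0)" for c
      using that unfolding scarf_basis_carrier by blast
    moreover have "\<zero>\<^bsub>quotient_module ?R ?J\<^esub> = ?J"
      by (simp add: quotient_module_def FactRing_def)
    ultimately show ?thesis
      unfolding taylor_diff_image_0[OF ms E_ne] module_ker_def by auto
  qed
  moreover have "(\<lambda>c. ?J +>\<^bsub>?R\<^esub> c {}) ` carrier (?F 0) = carrier (quotient_module ?R ?J)"
  proof (intro equalityI)
    show "(\<lambda>c. ?J +>\<^bsub>?R\<^esub> c {}) ` carrier (?F 0) \<subseteq> carrier (quotient_module ?R ?J)"
      using augmentation_hom[OF cover_ideal_ideal empty, where ?'k = 'k] unfolding module_hom_def by blast
    show "carrier (quotient_module ?R ?J) \<subseteq> (\<lambda>c. ?J +>\<^bsub>?R\<^esub> c {}) ` carrier (?F 0)"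
    proof
      fix X assume "X \<in> carrier (quotient_module ?R ?J)"
      then obtain r where r: "r \<in> carrier ?R" "X = ?J +>\<^bsub>?R\<^esub> r"
        by (auto simp: quotient_module_def FactRing_def A_RCOSETS_def' a_r_coset_def')
      have "(\<lambda>\<sigma>. if \<sigma> = {} then r else 0) \<in> carrier (?F 0)"
        using r(1) empty unfolding scarf_basis_carrier by simp
      then show "X \<in> (\<lambda>c. ?J +>\<^bsub>?R\<^esub> c {}) ` carrier (?F 0)"
        by (rule image_eqI[rotated]) (simp add: r(2))
    qed
  qed
  ultimately have "free_resolution ?R (quotient_module ?R ?J) (scarf_basis V E) (\<lambda>i. taylor_diff ms) (\<lambda>c. ?J +>\<^bsub>?R\<^esub> c {})"
    unfolding free_resolution_def Let_def
    using taylor_diff_hom[OF ms E_ne] augmentation_hom[OF cover_ideal_ideal empty] by (intro conjI allI)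
  moreover have "\<forall>i. \<forall>c\<in>carrier (?F (Suc i)). \<forall>b\<in>scarf_basis V E i. taylor_diff ms c b \<in> irrelevant_ideal V"
    using taylor_diff_irrelevant[OF ms] by blast
  ultimately have "minimal_free_resolution ?R (irrelevant_ideal V) (quotient_module ?R ?J) (scarf_basis V E)
      (\<lambda>i. taylor_diff ms) (\<lambda>c. ?J +>\<^bsub>?R\<^esub> c {})"
    unfolding minimal_free_resolution_def by (rule conjI)
  then show ?thesis
    unfolding scarf_ideal_def scarf_basis_eq
    using ms by (intro exI[of _ ms] conjI) (simp_all only: mingens_cover_ideal)
qed

end

end

theorem theorem1p4:
  fixes V :: "'v set" and E :: "'v set set"
  assumes "finite_simple_graph V E"
    and "V \<noteq> {}"
    and "chordal V E"
    and "\<forall>x\<in>V. nbhd V E x \<noteq> {}"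
  shows "scarf_ideal V (cover_ideal V E :: ('v, 'k::field) mpoly set) \<longleftrightarrow>
    (\<exists>A B. A \<union> B = V \<and> A \<inter> B = {} \<and> clique A E \<and> indep B E \<and>
       (\<forall>x\<in>A. \<exists>y\<in>B. {x, y} \<in> E) \<and>
       (\<forall>x\<in>A. \<forall>x'\<in>A. x \<noteq> x' \<longrightarrow> \<not> nbhd V E x \<inter> B \<subseteq> nbhd V E x' \<inter> B))"
proof -
  interpret simple_graph V E
    by unfold_locales (rule assms(1))
  \<comment> \<open>A vertex exists and is not isolated. Without edges the only minimal cover would
    be empty and the generator 1 would have the lcm of the empty family, so that singletons would
    fail to be Scarf faces.\<close>
  have E_ne: "E \<noteq> {}"
    using assms(2,4) by (auto simp: nbhd_def)
  show ?thesis
  proof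
    assume "scarf_ideal V (cover_ideal V E :: ('v, 'k) mpoly set)"
    then show "\<exists>A B. A \<union> B = V \<and> A \<inter> B = {} \<and> clique A E \<and> indep B E \<and>
       (\<forall>x\<in>A. \<exists>y\<in>B. {x, y} \<in> E) \<and>
       (\<forall>x\<in>A. \<forall>x'\<in>A. x \<noteq> x' \<longrightarrow> \<not> nbhd V E x \<inter> B \<subseteq> nbhd V E x' \<inter> B)"
      using assms(3) E_ne by (rule partition_of_scarf_ideal)
  next
    assume "\<exists>A B. A \<union> B = V \<and> A \<inter> B = {} \<and> clique A E \<and> indep B E \<and>
       (\<forall>x\<in>A. \<exists>y\<in>B. {x, y} \<in> E) \<and>
       (\<forall>x\<in>A. \<forall>x'\<in>A. x \<noteq> x' \<longrightarrow> \<not> nbhd V E x \<inter> B \<subseteq> nbhd V E x' \<inter> B)"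
    then show "scarf_ideal V (cover_ideal V E :: ('v, 'k) mpoly set)"
      using scarf_ideal_of_partition[OF _ _ _ _ _ _ E_ne] by (elim exE conjE)
  qed
qed

end
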